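(* Let $G$ be a finite group of order $n$. If $\psi(G) > \frac{31}{77}\,\psi(C_n)$, then $G$ is supersolvable.
   Context: All groups are finite. For a finite group $G$, $\psi(G)=\sum_{g\in G} o(g)$, where $o(g)$ is the order of $g$. $C_n$ denotes the cyclic group of order $n$. *)

theory Defs
  imports "HOL-Algebra.Algebra"
begin

definition psi :: "('a, 'b) monoid_scheme \<Rightarrow> nat" where
  "psi G = (\<Sum>x\<in>carrier G. group.ord G x)"

definition supersolvable :: "('a, 'b) monoid_scheme \<Rightarrow> bool" where
  "supersolvable G \<longleftrightarrow>
     (\<exists>(H :: nat \<Rightarrow> 'a set) k.
        H 0 = {\<one>\<^bsub>G\<^esub>} \<and> H k = carrier G \<and>
        (\<forall>i\<le>k. H i \<lhd> G) \<and>
        (\<forall>i<k. H i \<subseteq> H (Suc i) \<and>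
               cyclic_group ((G\<lparr>carrier := H (Suc i)\<rparr>) Mod (H i))))"

end

theory Submission
  imports Defs "HOL-Number_Theory.Totient"
begin

text \<open>
  Write f(n) for psi of the cyclic group of order n. Since psi(G) is at most |G| times the largest
  element order, some cyclic subgroup A = <x> has index i < (77/31) n^2/f(n), which is at most
  77/31 times the product of (p+1)/p over the primes p dividing n. If i >= 6, this forces a prime
  p > i to divide n. Then A contains a Sylow p-subgroup P of G, and the estimate |A|^2 <= |G| |A \<inter> A^g|
  shows that P lies in every conjugate of A, hence is normal. As psi(G) <= psi(P) psi(G/P), one
  may pass to G/P.

  It remains to treat i <= 5. If A is maximal and not normal, A \<inter> A^g is central in G. For i prime,
  G modulo this intersection has order i d with d < i and therefore a normal Sylow i-subgroup with
  cyclic quotient. For i = 4 the only obstruction is a central cyclic K with G/K of order 12 and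
  A/K of order 3 (so G/K is the alternating group A4). Counting element orders in
  the conjugates of A and in the three remaining cosets of K gives psi(G) <= 31/77 f(n) there.
\<close>

text \<open>The constant is the ratio for the alternating group A4: there psi is 1 + 3 * 2 + 8 * 3 =
  31, while f(12) = f(4) f(3) = 11 * 7 = 77. As A4 is not supersolvable, the hypothesis must be
  strict and the index four estimate has to be sharp at A4. The split at 6 comes from the same
  number: the primes up to 5 give 3/2 * 4/3 * 6/5 = 12/5, and 77/31 * 12/5 lies between 5 and 6,
  just below 6. Supersolvability does not pass to arbitrary extensions, because every term of the
  chain must be normal in the whole group; this is why each reduction divides by a normal cyclic
  subgroup, which costs a single step of the chain. Dividing by a cyclic Sylow subgroup P also
  preserves the hypothesis, because f is multiplicative and f(|P|) cancels from psi(P) psi(G/P) >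
  31/77 f(|P|) f(|G/P|).\<close>

hide_const (open) Divisibility.prime

section \<open>The sum of element orders of a cyclic group\<close>


text \<open>The f of the overview as a purely arithmetic function: C_n has \<open>totient d\<close>
  elements of order \<open>d\<close> for each divisor \<open>d\<close> of \<open>n\<close>.\<close>

definition cyclic_order_sum :: "nat \<Rightarrow> nat" where
  "cyclic_order_sum n = (\<Sum>d | d dvd n. d * totient d)"

lemma cyclic_order_sum_1 [simp]: "cyclic_order_sum 1 = 1" "cyclic_order_sum (Suc 0) = 1"
  by (simp_all add: cyclic_order_sum_def)

text \<open>The power x^j of an element of order n has order n / gcd n j, so the right side adds the
  orders of x^1, ..., x^n; grouping exponents by their gcd with n turns it into the divisor
  sum.\<close>

lemma cyclic_order_sum_gcd:
  assumes "n > 0"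
  shows "cyclic_order_sum n = (\<Sum>j\<in>{0<..n}. n div gcd n j)"
proof -
  have "(\<Sum>j\<in>{0<..n}. n div gcd n j) = (\<Sum>d | d dvd n. \<Sum>j | j \<in> {0<..n} \<and> gcd n j = d. n div gcd n j)"
    using assms by (intro sum.group[symmetric]) auto
  also have "\<dots> = (\<Sum>d | d dvd n. totient (n div d) * (n div d))"
  proof (rule sum.cong)
    fix d assume "d \<in> {d. d dvd n}"
    hence "card {j \<in> {0<..n}. gcd j n = d} = totient (n div d)"
      using assms card_gcd_eq_totient by auto
    moreover have "{j. j \<in> {0<..n} \<and> gcd n j = d} = {j \<in> {0<..n}. gcd j n = d}"
      by (auto simp: gcd.commute)
    moreover have "(\<Sum>j | j \<in> {0<..n} \<and> gcd n j = d. n div gcd n j)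
        = (\<Sum>j | j \<in> {0<..n} \<and> gcd n j = d. n div d)"
      by (rule sum.cong) auto
    ultimately show "(\<Sum>j | j \<in> {0<..n} \<and> gcd n j = d. n div gcd n j) = totient (n div d) * (n div d)"
      by simp
  qed simp
  also have "\<dots> = cyclic_order_sum n"
    unfolding cyclic_order_sum_def
    by (rule sum.reindex_bij_witness[of _ "\<lambda>d. n div d" "\<lambda>d. n div d"])
       (use assms in \<open>auto simp: dvd_div_eq_mult\<close>)
  finally show ?thesis by simp
qed

text \<open>Divisors of p^(a+1) m either divide p^a m or carry the full power of p. The latter are
  p^(a+1) e with e dividing m, and the totient splits over these coprime factors.\<close>

lemma cyclic_order_sum_prime_Suc:
  assumes p: "prime p" and m: "\<not> p dvd m" "m > 0"
  shows "cyclic_order_sum (p ^ Suc a * m)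
    = cyclic_order_sum (p ^ a * m) + p ^ Suc a * totient (p ^ Suc a) * cyclic_order_sum m"
proof -
  have p0: "p > 0" using p prime_gt_0_nat by blast
  have cop: "coprime (p ^ Suc a) e" if "e dvd m" for e
    using p m that by (metis coprime_power_left_iff dvd_trans prime_imp_coprime)
  have split: "{d. d dvd p ^ Suc a * m} = {d. d dvd p ^ a * m} \<union> (\<lambda>e. p ^ Suc a * e) ` {e. e dvd m}"
  proof (intro equalityI subsetI)
    fix d assume "d \<in> {d. d dvd p ^ Suc a * m}"
    then obtain b e where be: "d = b * e" "b dvd p ^ Suc a" "e dvd m"
      using division_decomp by blast
    then obtain i where i: "i \<le> Suc a" "b = p ^ i"
      using p divides_primepow_nat by blast
    show "d \<in> {d. d dvd p ^ a * m} \<union> (\<lambda>e. p ^ Suc a * e) ` {e. e dvd m}"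
    proof (cases "i = Suc a")
      case False
      hence "b dvd p ^ a" using i by (simp add: le_imp_power_dvd)
      thus ?thesis using be by (simp add: mult_dvd_mono)
    qed (use be i in auto)
  next
    fix d assume "d \<in> {d. d dvd p ^ a * m} \<union> (\<lambda>e. p ^ Suc a * e) ` {e. e dvd m}"
    thus "d \<in> {d. d dvd p ^ Suc a * m}"
      by (auto intro: mult_dvd_mono dvd_mult simp: mult.assoc)
  qed
  have disj: "{d. d dvd p ^ a * m} \<inter> (\<lambda>e. p ^ Suc a * e) ` {e. e dvd m} = {}"
  proof -
    have "\<not> p ^ Suc a * e dvd p ^ a * m" for e
    proof
      assume "p ^ Suc a * e dvd p ^ a * m"
      hence "p ^ a * p dvd p ^ a * m" by (metis dvd_mult_left power_Suc2)
      thus False using p0 m by simp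
    qed
    thus ?thesis by auto
  qed
  have "(\<Sum>d\<in>(\<lambda>e. p ^ Suc a * e) ` {e. e dvd m}. d * totient d)
      = (\<Sum>e | e dvd m. (p ^ Suc a * e) * totient (p ^ Suc a * e))"
    using p0 by (subst sum.reindex) (auto simp: inj_on_def)
  also have "\<dots> = (\<Sum>e | e dvd m. p ^ Suc a * totient (p ^ Suc a) * (e * totient e))"
    using totient_mult_coprime[OF cop] by (intro sum.cong refl) (simp only: mem_Collect_eq mult_ac)
  also have "\<dots> = p ^ Suc a * totient (p ^ Suc a) * cyclic_order_sum m"
    by (simp add: cyclic_order_sum_def sum_distrib_left)
  finally show ?thesis
    unfolding cyclic_order_sum_def split using disj m p0
    by (subst sum.union_disjoint) auto
qed

text \<open>The closed form f(p^a) = (p^(2a+1) + 1) / (p + 1), cleared of its denominator. Carrying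
  the coprime cofactor m through the induction makes multiplicativity a corollary.\<close>

lemma cyclic_order_sum_prime_power:
  assumes p: "prime p" and m: "\<not> p dvd m" "m > 0"
  shows "(p + 1) * cyclic_order_sum (p ^ a * m) = (p ^ (2 * a + 1) + 1) * cyclic_order_sum m"
proof (induction a)
  case (Suc a)
  \<comment> \<open>Here q is p - 1, named to keep truncated subtraction out of the algebra; the
    closing identity is 1 + (p + 1)(p - 1) = p^2.\<close>
  obtain q where q: "p = Suc q" using p prime_gt_0_nat gr0_implies_Suc by blast
  have t: "totient (p ^ Suc a) = p ^ a * q"
    using totient_prime_power_Suc[OF p] q by simp
  have "(p + 1) * cyclic_order_sum (p ^ Suc a * m)
    = (p ^ (2 * a + 1) + 1) * cyclic_order_sum m + (p + 1) * (p ^ Suc a * (p ^ a * q)) * cyclic_order_sum m"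
    unfolding cyclic_order_sum_prime_Suc[OF p m, of a] t add_mult_distrib2 Suc by (simp only: mult.assoc)
  also have "\<dots> = (p ^ (2 * a + 1) * (1 + (p + 1) * q) + 1) * cyclic_order_sum m"
  proof -
    have "p ^ Suc a * (p ^ a * q) = p ^ (2 * a + 1) * q" by (simp add: power_add mult_2)
    hence e: "(p + 1) * (p ^ Suc a * (p ^ a * q)) = p ^ (2 * a + 1) * ((p + 1) * q)" by (simp only: mult_ac)
    show ?thesis unfolding e by (simp only: distrib_left distrib_right mult_1_right add.assoc add.commute add.left_commute)
  qed
  also have "1 + (p + 1) * q = p ^ 2" by (simp add: q power2_eq_square)
  also have "p ^ (2 * a + 1) * p ^ 2 = p ^ (2 * Suc a + 1)" by (simp flip: power_add)
  finally show ?case .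
qed simp

lemma cyclic_order_sum_prime_power_mult:
  assumes p: "prime p" and m: "\<not> p dvd m" "m > 0"
  shows "cyclic_order_sum (p ^ a * m) = cyclic_order_sum (p ^ a) * cyclic_order_sum m"
proof -
  have "(p + 1) * cyclic_order_sum (p ^ a * m) = (p + 1) * (cyclic_order_sum (p ^ a) * cyclic_order_sum m)"
    using cyclic_order_sum_prime_power[OF p m, of a] cyclic_order_sum_prime_power[OF p, of 1 a] p
    by (metis One_nat_def cyclic_order_sum_1(1) mult.assoc mult.right_neutral nat_dvd_1_iff_1 not_prime_1 zero_less_one)
  thus ?thesis by (simp only: mult_cancel1) simp
qed

lemma prime_power_decomp:
  fixes n :: nat
  assumes "prime p" "n > 0"
  obtains a m where "n = p ^ a * m" "\<not> p dvd m" "m > 0"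
  using assms multiplicity_decompose'[of n p] by (metis gr0I mult_0_right not_gr_zero not_prime_unit)

text \<open>The ratio f(3m) / f(m) is smallest when 3 does not divide m, and there it equals f(3) =
  7.\<close>

lemma cyclic_order_sum_3:
  assumes "m > 0"
  shows "7 * cyclic_order_sum m \<le> cyclic_order_sum (3 * m)"
proof -
  obtain a k where k: "m = 3 ^ a * k" "\<not> 3 dvd k" "k > 0"
    using prime_power_decomp[of 3 m] assms by auto
  have p: "prime (3::nat)" by simp
  have "4 * (7 * cyclic_order_sum m) = 7 * (3 ^ (2 * a + 1) + 1) * cyclic_order_sum k"
    using cyclic_order_sum_prime_power[OF p k(2,3), of a] k(1) by (simp add: algebra_simps)
  also have "\<dots> \<le> (3 ^ (2 * Suc a + 1) + 1) * cyclic_order_sum k"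
    by (intro mult_right_mono) auto
  also have "\<dots> = 4 * cyclic_order_sum (3 * m)"
    using cyclic_order_sum_prime_power[OF p k(2,3), of "Suc a"] k(1) by (simp add: mult_ac)
  finally show ?thesis by simp
qed

text \<open>For odd m the ratio f(4m) / f(m) is exactly f(4) = 11; one factor 2 in m already lifts
  it to at least 129/9. The larger constant pays for the central involution that appears in the
  index four estimate when K has even order.\<close>

lemma cyclic_order_sum_4:
  assumes "m > 0"
  shows "(if even m then 14 else 11) * cyclic_order_sum m \<le> cyclic_order_sum (4 * m)"
proof -
  obtain a k where k: "m = 2 ^ a * k" "\<not> 2 dvd k" "k > 0"
    using prime_power_decomp[of 2 m] assms by auto
  have p: "prime (2::nat)" by simp
  define c where "c = (if even m then 14 else 11 :: nat)"
  have "c * (2 ^ (2 * a + 1) + 1) \<le> 2 ^ (2 * (a + 2) + 1) + 1"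
  proof (cases a)
    case 0 thus ?thesis using k by (simp add: c_def)
  next
    case (Suc b)
    have "(1::nat) \<le> 4 ^ b" by simp
    hence "13 \<le> 16 * (4::nat) ^ b" by linarith
    thus ?thesis using Suc k by (simp add: c_def power_mult)
  qed
  hence "c * (2 ^ (2 * a + 1) + 1) * cyclic_order_sum k \<le> (2 ^ (2 * (a + 2) + 1) + 1) * cyclic_order_sum k"
    by (rule mult_le_mono1)
  moreover have "3 * cyclic_order_sum m = (2 ^ (2 * a + 1) + 1) * cyclic_order_sum k"
    using cyclic_order_sum_prime_power[OF p k(2,3), of a] unfolding k(1) by simp
  ultimately have "3 * (c * cyclic_order_sum m) \<le> (2 ^ (2 * (a + 2) + 1) + 1) * cyclic_order_sum k"
    by (simp only: mult.assoc mult.left_commute[of 3])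
  also have "\<dots> = 3 * cyclic_order_sum (4 * m)"
    using cyclic_order_sum_prime_power[OF p k(2,3), of "a + 2"] k(1) by (simp add: mult_ac power_add)
  finally show ?thesis by (simp add: c_def)
qed

section \<open>The size of n^2 / f(n) in terms of the primes dividing n\<close>

lemma cyclic_order_sum_lower:
  assumes "n > 0"
  shows "n ^ 2 * (\<Prod>p\<in>prime_factors n. p) \<le> cyclic_order_sum n * (\<Prod>p\<in>prime_factors n. p + 1)"
  using assms
proof (induction n rule: less_induct)
  case (less n)
  show ?case
  proof (cases "n = 1")
    case False
    then obtain p where p: "prime p" "p dvd n" using prime_factor_nat by blast
    then obtain a m where m: "n = p ^ a * m" "\<not> p dvd m" "m > 0"
      using prime_power_decomp less.prems by blast
    have a: "a > 0" using p m by (cases a) auto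
    have p1: "p > 1" using p prime_gt_1_nat by blast
    have "1 < p ^ a" using a p1 one_less_power by blast
    hence lt: "m < n" using m by simp
    have pf: "prime_factors n = insert p (prime_factors m)" 
      unfolding m(1) using m p a
      by (subst prime_factors_product) (auto simp: prime_factors_power prime_prime_factors prime_gt_0_nat)
    have notin: "p \<notin> prime_factors m" using m by auto
    have IH: "m ^ 2 * (\<Prod>p\<in>prime_factors m. p) \<le> cyclic_order_sum m * (\<Prod>p\<in>prime_factors m. p + 1)"
      using less.IH[OF lt m(3)] .
    have "n ^ 2 * (\<Prod>p\<in>prime_factors n. p) = p ^ (2 * a + 1) * (m ^ 2 * (\<Prod>p\<in>prime_factors m. p))"
      unfolding pf using notin by (simp add: m(1) power_mult_distrib power_mult[symmetric] mult_ac)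
    \<comment> \<open>The loss at p is just the + 1 of the closed form: p^(2a) / f(p^a) is at most
      (p + 1) / p.\<close>
    also have "\<dots> \<le> (p ^ (2 * a + 1) + 1) * (cyclic_order_sum m * (\<Prod>p\<in>prime_factors m. p + 1))"
      by (intro mult_mono IH) auto
    also have "\<dots> = ((p + 1) * cyclic_order_sum n) * (\<Prod>p\<in>prime_factors m. p + 1)"
      using cyclic_order_sum_prime_power[OF p(1) m(2,3), of a] by (simp only: m(1) mult.assoc[symmetric])
    also have "\<dots> = cyclic_order_sum n * (\<Prod>p\<in>prime_factors n. p + 1)"
      unfolding pf using notin by (simp add: mult_ac del: mult_Suc mult_Suc_right)
    finally show ?thesis .
  qed simp
qed

text \<open>Beyond 6 the factor (p + 1) / p of each new prime p is absorbed by the growth of the bound,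
  because i (i + 2) <= (i + 1)^2.\<close>

lemma prod_primes_le:
  assumes "i \<ge> 6"
  shows "77 * (\<Prod>p | prime p \<and> p \<le> i. p + 1) \<le> 31 * i * (\<Prod>p | prime p \<and> p \<le> (i::nat). p)"
  using assms
proof (induction i rule: dec_induct)
  case base
  have "{p::nat. prime p \<and> p \<le> 6} = {2,3,5}"
  proof -
    have "p \<in> {2,3,5}" if "prime p" "p \<le> 6" for p :: nat
    proof -
      have "p = 0 \<or> p = 1 \<or> p = 2 \<or> p = 3 \<or> p = 4 \<or> p = 5 \<or> p = 6" using that(2) by presburger
      moreover have "\<not> prime (4::nat)" "\<not> prime (6::nat)" using prime_product[of 2 "2::nat"] prime_product[of 2 "3::nat"] by auto
      ultimately show ?thesis using that by auto
    qed
    moreover have "prime (5::nat)" by simp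
    ultimately show ?thesis by auto
  qed
  \<comment> \<open>Numerically 77 * 72 = 5544 against 31 * 6 * 30 = 5580. With 5 in place of 6 the
    right side would be 4650, which is why indices below 6 need structural arguments.\<close>
  thus ?case by simp
next
  case (step i)
  let ?P = "\<lambda>i. {p::nat. prime p \<and> p \<le> i}"
  show ?case
  proof (cases "prime (Suc i)")
    case True
    have eq: "?P (Suc i) = insert (Suc i) (?P i)" using True by (auto simp: le_Suc_eq)
    have fin: "finite (?P i)" "Suc i \<notin> ?P i" by auto
    have "77 * (\<Prod>p\<in>?P (Suc i). p + 1) = (i + 2) * (77 * (\<Prod>p\<in>?P i. p + 1))"
      unfolding eq using fin by (simp add: algebra_simps)
    also have "\<dots> \<le> (i + 2) * (31 * i * (\<Prod>p\<in>?P i. p))"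
      by (intro mult_left_mono step.IH) auto
    also have "\<dots> = (i + 2) * i * (31 * (\<Prod>p\<in>?P i. p))" by (simp only: mult_ac)
    also have "\<dots> \<le> (Suc i * Suc i) * (31 * (\<Prod>p\<in>?P i. p))"
      by (intro mult_right_mono) auto
    also have "\<dots> = 31 * Suc i * (\<Prod>p\<in>?P (Suc i). p)"
      unfolding eq prod.insert[OF fin] by (simp only: mult_ac)
    finally show ?thesis .
  next
    case False
    hence eq: "?P (Suc i) = ?P i" by (auto simp: le_Suc_eq)
    have "31 * i * (\<Prod>p\<in>?P i. p) \<le> 31 * Suc i * (\<Prod>p\<in>?P i. p)" by (intro mult_right_mono) auto
    thus ?thesis unfolding eq using step.IH by linarith
  qed
qed

text \<open>Removing a prime p from the full product divides the left side by p + 1 and the right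
  side only by p, so the worst case is the set of all primes up to i.\<close>

lemma prod_prime_subset_le:
  assumes "i \<ge> 6" "S \<subseteq> {p. prime p \<and> p \<le> (i::nat)}"
  shows "77 * (\<Prod>p\<in>S. p + 1) \<le> 31 * i * \<Prod>S"
proof -
  define T where "T = {p. prime p \<and> p \<le> i} - S"
  have fin: "finite {p. prime p \<and> p \<le> i}" by auto
  have split: "(\<Prod>p | prime p \<and> p \<le> i. g p) = (\<Prod>p\<in>S. g p) * (\<Prod>p\<in>T. g p)" for g :: "nat \<Rightarrow> nat"
    unfolding T_def using prod.subset_diff[OF assms(2) fin, of g] by (simp add: mult.commute)
  have T0: "\<Prod>T > 0" by (rule prod_pos) (auto simp: T_def prime_gt_0_nat)
  have "(\<Prod>p\<in>S. p + 1) * \<Prod>T * 77 \<le> 77 * ((\<Prod>p\<in>S. p + 1) * (\<Prod>p\<in>T. p + 1))"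
    by (simp add: prod_mono mult.assoc)
  also have "\<dots> \<le> 31 * i * (\<Prod>S * \<Prod>T)"
    using prod_primes_le[OF assms(1)] split[of "\<lambda>p. p + 1"] split[of "\<lambda>p. p"] by simp
  finally have "(77 * (\<Prod>p\<in>S. p + 1)) * \<Prod>T \<le> (31 * i * \<Prod>S) * \<Prod>T" by (simp add: mult_ac)
  thus ?thesis using T0 by (simp only: mult_le_cancel2)
qed

text \<open>If every prime divisor of n were at most i, the two product bounds would combine to 77
  n^2 <= 31 i f(n).\<close>

lemma large_prime_divisor:
  assumes "n > 0" "i \<ge> 6" and less: "31 * i * cyclic_order_sum n < 77 * n ^ 2"
  shows "\<exists>p. prime p \<and> p dvd n \<and> i < p"
proof (rule ccontr)
  assume none: "\<not> ?thesis"
  have "p \<le> i" if "p \<in> prime_factors n" for p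
    using that none by (meson in_prime_factors_iff not_le)
  hence sub: "prime_factors n \<subseteq> {p. prime p \<and> p \<le> i}" by auto
  have pos: "\<Prod>(prime_factors n) > 0"
    by (rule prod_pos) (simp add: in_prime_factors_iff prime_gt_0_nat)
  have "77 * (n ^ 2 * \<Prod>(prime_factors n)) \<le> cyclic_order_sum n * (77 * (\<Prod>p\<in>prime_factors n. p + 1))"
    using mult_le_mono2[OF cyclic_order_sum_lower[OF assms(1)], of 77] by (simp only: mult.left_commute)
  also have "\<dots> \<le> cyclic_order_sum n * (31 * i * \<Prod>(prime_factors n))"
    by (intro mult_left_mono prod_prime_subset_le assms(2) sub) auto
  finally have "77 * n ^ 2 * \<Prod>(prime_factors n) \<le> 31 * i * cyclic_order_sum n * \<Prod>(prime_factors n)"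
    by (simp only: mult_ac)
  hence "77 * n ^ 2 \<le> 31 * i * cyclic_order_sum n" using pos by (simp only: mult_le_cancel2)
  thus False using less by linarith
qed

section \<open>Element orders in cyclic subgroups and in the integers modulo n\<close>

lemma (in group) generate_eq_pow_image:
  assumes "finite (carrier G)" "x \<in> carrier G"
  shows "generate G {x} = (\<lambda>j::nat. x [^] j) ` {1..ord x}"
proof -
  have "(\<lambda>j::nat. x [^] j) ` {1..ord x} \<subseteq> generate G {x}"
    using generate_pow_on_finite_carrier[OF assms] by auto
  moreover have "card ((\<lambda>j::nat. x [^] j) ` {1..ord x}) = card (generate G {x})"
    using card_image[OF ord_inj'[OF assms(2)]] generate_pow_card[OF assms(2)] by simp
  moreover have "finite (generate G {x})"
    using assms generate_incl[of "{x}"] finite_subset by blast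
  ultimately show ?thesis by (metis card_subset_eq)
qed

lemma (in group) sum_ord_generate:
  assumes "finite (carrier G)" "x \<in> carrier G"
  shows "(\<Sum>h\<in>generate G {x}. ord h) = cyclic_order_sum (ord x)"
proof -
  have "(\<Sum>h\<in>generate G {x}. ord h) = (\<Sum>j\<in>{1..ord x}. ord (x [^] j))"
    unfolding generate_eq_pow_image[OF assms] using ord_inj'[OF assms(2)] by (simp add: sum.reindex)
  also have "\<dots> = (\<Sum>j\<in>{0<..ord x}. ord x div gcd (ord x) j)"
    using ord_pow_gen[OF assms(2)] by (intro sum.cong) auto
  also have "\<dots> = cyclic_order_sum (ord x)"
    using ord_ge_1[OF assms] by (intro cyclic_order_sum_gcd[symmetric]) simp
  finally show ?thesis .
qed

lemma psi_integer_mod_group: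
  assumes "n > 0"
  shows "psi (integer_mod_group n) = cyclic_order_sum n"
proof -
  interpret Z: group "integer_mod_group n" by simp
  have fin: "finite (carrier (integer_mod_group n))" and card: "card (carrier (integer_mod_group n)) = n"
    using assms by (simp_all add: carrier_integer_mod_group)
  show ?thesis
  proof (cases "n = 1")
    case True
    have "carrier (integer_mod_group n) = {\<one>\<^bsub>integer_mod_group n\<^esub>}"
      using True by (auto simp: carrier_integer_mod_group)
    thus ?thesis using True Z.ord_id by (simp add: psi_def del: one_integer_mod_group)
  next
    case False
    hence one: "1 \<in> carrier (integer_mod_group n)" by simp
    have "Z.ord 1 = n"
      unfolding Z.ord_unique[OF one] using of_nat_dvd_iff[of n] by (auto simp: mod_eq_0_iff_dvd)
    moreover from this have "generate (integer_mod_group n) {1} = carrier (integer_mod_group n)"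
      using Z.generate_pow_card[OF one] Z.generate_incl[of "{1}"] one fin card by (intro card_subset_eq) auto
    ultimately show ?thesis
      using Z.sum_ord_generate[OF fin one] by (simp add: psi_def)
  qed
qed

section \<open>Supersolvable chains\<close>

text \<open>Cyclicity of M / N stated with elements instead of cosets, which makes it easy to pull
  back along homomorphisms. As n runs over all integers, y x^n in N says that y is a power of x
  modulo N.\<close>

definition cyclic_step :: "('a, 'b) monoid_scheme \<Rightarrow> 'a set \<Rightarrow> 'a set \<Rightarrow> bool" where
  "cyclic_step G N M \<longleftrightarrow> (\<exists>x\<in>M. \<forall>y\<in>M. \<exists>n::int. y \<otimes>\<^bsub>G\<^esub> x [^]\<^bsub>G\<^esub> n \<in> N)"

lemma (in group) cyclic_group_Mod_iff:
  assumes N: "N \<lhd> G" and M: "subgroup M G" and sub: "N \<subseteq> M"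
  shows "cyclic_group ((G\<lparr>carrier := M\<rparr>) Mod N) \<longleftrightarrow> cyclic_step G N M"
proof -
  let ?M = "G\<lparr>carrier := M\<rparr>"
  have MG: "M \<subseteq> carrier G" using M subgroup.subset by blast
  have Ns: "subgroup N G" using N normal_imp_subgroup by blast
  interpret M: group ?M by (rule subgroup_imp_group[OF M])
  interpret N: normal N ?M by (rule normal_restrict_supergroup[OF M N sub])
  interpret Q: group "?M Mod N" by (rule N.factorgroup_is_group)
  have coset: "N #> y = N #> z \<longleftrightarrow> y \<otimes> inv z \<in> N" if "y \<in> M" "z \<in> M" for y z
    using that MG Ns subgroup.rcos_module[OF Ns is_group, of z y] repr_independence[OF _ _ Ns, of y z]
      rcos_self[OF _ Ns, of y] by auto
  have pow: "x [^]\<^bsub>?M\<^esub> n = x [^] n" if "x \<in> M" for x and n :: int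
    using int_pow_consistent[OF M that] by simp
  have powM: "x [^] n \<in> M" if "x \<in> M" for x and n :: int
    using pow[OF that] M.int_pow_closed[of x n] that by simp
  have carrierQ: "carrier (?M Mod N) = (\<lambda>x. N #> x) ` M"
    by (simp add: carrier_FactGroup)
  have powQ: "(N #> x) [^]\<^bsub>?M Mod N\<^esub> n = N #> (x [^] n)" if "x \<in> M" for x and n :: int
    using N.FactGroup_int_pow[of x n] that pow[OF that] by simp
  have "cyclic_group (?M Mod N) \<longleftrightarrow> (\<exists>x\<in>M. (\<lambda>x. N #> x) ` M = range (\<lambda>n::int. N #> (x [^] n)))"
    unfolding Q.cyclic_group carrierQ by (auto simp: powQ)
  also have "\<dots> \<longleftrightarrow> (\<exists>x\<in>M. \<forall>y\<in>M. \<exists>n::int. N #> y = N #> (x [^] n))"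
    using powM by (intro bex_cong refl) (auto simp: set_eq_iff image_iff; blast)
  also have "\<dots> \<longleftrightarrow> (\<exists>x\<in>M. \<forall>y\<in>M. \<exists>n::int. y \<otimes> inv (x [^] n) \<in> N)"
    using powM coset by (intro bex_cong ball_cong refl) auto
  also have "\<dots> \<longleftrightarrow> cyclic_step G N M"
  proof -
    have "(\<exists>n::int. y \<otimes> inv (x [^] n) \<in> N) \<longleftrightarrow> (\<exists>n::int. y \<otimes> x [^] n \<in> N)" if "x \<in> M" for x y
      using that MG int_pow_neg[of x] by (metis add.inverse_inverse subsetD)
    thus ?thesis unfolding cyclic_step_def by (intro bex_cong ball_cong refl)
  qed
  finally show ?thesis .
qed

text \<open>An inductive form of the indexed chains, in which a chain may stop at any normal
  subgroup and be extended from there. Every term is normal in the whole of G, not merely in the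
  next one.\<close>

inductive super_chain :: "('a, 'b) monoid_scheme \<Rightarrow> 'a set \<Rightarrow> bool" for G where
  base: "super_chain G {\<one>\<^bsub>G\<^esub>}"
| step: "super_chain G N \<Longrightarrow> N \<subseteq> M \<Longrightarrow> M \<lhd> G \<Longrightarrow> cyclic_step G N M \<Longrightarrow> super_chain G M"

lemma (in group) supersolvable_iff: "supersolvable G \<longleftrightarrow> super_chain G (carrier G)"
proof
  assume "supersolvable G"
  then obtain H :: "nat \<Rightarrow> 'a set" and k where H: "H 0 = {\<one>} \<and> H k = carrier G \<and> (\<forall>i\<le>k. H i \<lhd> G) \<and>
      (\<forall>i<k. H i \<subseteq> H (Suc i) \<and> cyclic_group ((G\<lparr>carrier := H (Suc i)\<rparr>) Mod (H i)))"
    unfolding supersolvable_def by (elim exE)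
  have "i \<le> k \<Longrightarrow> super_chain G (H i)" for i
  proof (induction i)
    case (Suc i)
    hence "H i \<lhd> G" "H (Suc i) \<lhd> G" "H i \<subseteq> H (Suc i)"
        "cyclic_group ((G\<lparr>carrier := H (Suc i)\<rparr>) Mod (H i))"
      using H by auto
    thus ?case
      using Suc cyclic_group_Mod_iff[of "H i" "H (Suc i)"] normal_imp_subgroup[of "H (Suc i)"]
        super_chain.step[of G "H i" "H (Suc i)"] by auto
  qed (use H super_chain.base[of G] in simp)
  from this[of k] show "super_chain G (carrier G)" using H by simp
next
  have "\<exists>H k. H 0 = {\<one>} \<and> H k = N \<and> (\<forall>i\<le>k. H i \<lhd> G) \<and>
     (\<forall>i<k. H i \<subseteq> H (Suc i) \<and> cyclic_group ((G\<lparr>carrier := H (Suc i)\<rparr>) Mod (H i)))"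
    if "super_chain G N" for N
    using that
  proof (induction rule: super_chain.induct)
    case base
    show ?case by (rule exI[of _ "\<lambda>_. {\<one>}"], rule exI[of _ 0]) (simp add: one_is_normal)
  next
    case (step N M)
    from step.IH obtain H k where H: "H 0 = {\<one>} \<and> H k = N \<and> (\<forall>i\<le>k. H i \<lhd> G) \<and>
      (\<forall>i<k. H i \<subseteq> H (Suc i) \<and> cyclic_group ((G\<lparr>carrier := H (Suc i)\<rparr>) Mod (H i)))"
      by (elim exE)
    hence "N \<lhd> G" by auto
    hence "cyclic_group ((G\<lparr>carrier := M\<rparr>) Mod N)"
      using step.hyps cyclic_group_Mod_iff[of N M] normal_imp_subgroup[of M G] by simp
    thus ?case using H step.hyps
      by (intro exI[of _ "H(Suc k := M)"] exI[of _ "Suc k"]) (auto simp: less_Suc_eq le_Suc_eq)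
  qed
  thus "super_chain G (carrier G) \<Longrightarrow> supersolvable G"
    unfolding supersolvable_def by blast
qed

section \<open>Lifting chains from quotients\<close>

lemma (in group_hom) normal_preimage:
  assumes "M \<lhd> H"
  shows "{g \<in> carrier G. h g \<in> M} \<lhd> G"
proof -
  interpret M: normal M H by fact
  have "subgroup {g \<in> carrier G. h g \<in> M} G"
    by (rule G.subgroupI) (use M.one_closed in \<open>auto intro: exI[of _ "\<one>"]\<close>)
  thus ?thesis
    unfolding G.normal_inv_iff by (auto intro: M.inv_op_closed2)
qed

text \<open>Preimages of normal subgroups are normal in G and generators lift, so each step of a
  chain of H pulls back. The bottom term pulls back to the kernel, where the given chain of G takes
  over.\<close>

lemma (in group_hom) super_chain_preimage:
  assumes surj: "h ` carrier G = carrier H" and ker: "super_chain G (kernel G H h)" and "super_chain H M"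
  shows "super_chain G {g \<in> carrier G. h g \<in> M}"
  using assms(3)
proof (induction rule: super_chain.induct)
  case base
  show ?case using ker by (simp add: kernel_def)
next
  case (step N M)
  have MH: "M \<subseteq> carrier H" using step normal_imp_subgroup subgroup.subset by blast
  obtain x where x: "x \<in> M" "\<And>y. y \<in> M \<Longrightarrow> \<exists>n::int. y \<otimes>\<^bsub>H\<^esub> x [^]\<^bsub>H\<^esub> n \<in> N"
    using step.hyps unfolding cyclic_step_def by blast
  then obtain g where g: "g \<in> carrier G" "x = h g" using surj MH x(1) by (metis imageE subsetD)
  have "cyclic_step G {g \<in> carrier G. h g \<in> N} {g \<in> carrier G. h g \<in> M}"
    unfolding cyclic_step_def
  proof (intro bexI[of _ g] ballI)
    fix y assume y: "y \<in> {g \<in> carrier G. h g \<in> M}"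
    then obtain n :: int where "h y \<otimes>\<^bsub>H\<^esub> x [^]\<^bsub>H\<^esub> n \<in> N" using x(2) by blast
    thus "\<exists>n::int. y \<otimes> g [^] n \<in> {g \<in> carrier G. h g \<in> N}"
      using y g by (intro exI[of _ n]) (simp add: hom_int_pow)
  qed (use x g in auto)
  thus ?case using step normal_preimage by (intro super_chain.step[OF step.IH]) auto
qed

lemma (in group_hom) supersolvable_preimage:
  assumes surj: "h ` carrier G = carrier H" and "super_chain G (kernel G H h)" and "supersolvable H"
  shows "supersolvable G"
proof -
  have "{g \<in> carrier G. h g \<in> carrier H} = carrier G" by auto
  thus ?thesis using super_chain_preimage[of "carrier H"] assms G.supersolvable_iff H.supersolvable_iff by simp
qed

lemma (in group) cyclic_step_generate:
  assumes "x \<in> carrier G"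
  shows "cyclic_step G {\<one>} (generate G {x})"
  unfolding cyclic_step_def
proof (intro bexI[of _ x] ballI)
  fix y assume "y \<in> generate G {x}"
  then obtain n :: int where "y = x [^] n" using generate_pow[OF assms] by auto
  thus "\<exists>n::int. y \<otimes> x [^] n \<in> {\<one>}"
    using assms int_pow_neg[of x n] by (intro exI[of _ "- n"]) simp
qed (simp add: generate.incl)

lemma (in group) super_chain_generate:
  assumes "x \<in> carrier G" "generate G {x} \<lhd> G"
  shows "super_chain G (generate G {x})"
  using super_chain.step[OF super_chain.base _ assms(2)] cyclic_step_generate[OF assms(1)] generate.one
  by auto

text \<open>The quotient is realised on coset representatives, so that it has the same element type as G
  and induction over quotients is possible.\<close>

lemma (in normal) quotient_exists:
  obtains Q :: "'a monoid" and f
  where "group_hom G Q f" "f ` carrier G = carrier Q" "kernel G Q f = H"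
    "order Q * card H = order G"
proof -
  define rep where "rep = (\<lambda>U::'a set. SOME g. g \<in> U)"
  define Q where "Q = flatten (G Mod H) rep"
  define f where "f = (\<lambda>a. rep (H #> a))"
  interpret Q: group Q unfolding Q_def rep_def by (rule flatten_set_group_mod)
  have iso: "rep \<in> iso (G Mod H) Q" unfolding Q_def rep_def by (rule flatten_set_group_mod_iso)
  interpret R: group_hom "G Mod H" Q rep
    using iso factorgroup_is_group Q.is_group by (auto simp: group_hom_def group_hom_axioms_def iso_def)
  interpret C: group_hom G "G Mod H" "\<lambda>a. H #> a"
    using r_coset_hom_Mod factorgroup_is_group is_group by (auto simp: group_hom_def group_hom_axioms_def)
  have inj: "inj_on rep (carrier (G Mod H))" and im: "rep ` carrier (G Mod H) = carrier Q"
    using iso by (auto simp: iso_def bij_betw_def)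
  have "f \<in> hom G Q"
    unfolding hom_def f_def by (auto simp del: mult_FactGroup)
  hence hom: "group_hom G Q f"
    by (simp add: group_hom_def group_hom_axioms_def is_group Q.is_group)
  have surj: "f ` carrier G = carrier Q"
    unfolding im[symmetric] f_def carrier_FactGroup by auto
  have "f a = \<one>\<^bsub>Q\<^esub> \<longleftrightarrow> a \<in> H" if "a \<in> carrier G" for a
  proof -
    have "f a = \<one>\<^bsub>Q\<^esub> \<longleftrightarrow> rep (H #> a) = rep H"
      using R.hom_one by (simp add: f_def)
    also have "\<dots> \<longleftrightarrow> H #> a = H"
      using inj_on_eq_iff[OF inj, of "H #> a" H] that C.hom_closed R.G.one_closed by simp
    also have "\<dots> \<longleftrightarrow> a \<in> H"
      using that rcos_self[OF that is_subgroup] coset_join2[OF that is_subgroup] by auto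
    finally show ?thesis .
  qed
  hence ker: "kernel G Q f = H" unfolding kernel_def using subset by auto
  have "order Q = order (G Mod H)" using iso_same_order[OF iso] by simp
  hence "order Q * card H = order G"
    using lagrange[OF is_subgroup] by (simp add: order_def FactGroup_def)
  with hom surj ker show thesis using that by blast
qed

section \<open>Cyclic subgroups and their conjugates\<close>

lemma (in group) conj_pow:
  assumes "g \<in> carrier G" "a \<in> carrier G"
  shows "(g \<otimes> a \<otimes> inv g) [^] (n::nat) = g \<otimes> a [^] n \<otimes> inv g"
proof (induction n)
  case (Suc n)
  have "g \<otimes> a [^] n \<otimes> inv g \<otimes> (g \<otimes> a \<otimes> inv g) = g \<otimes> a [^] n \<otimes> (inv g \<otimes> g) \<otimes> a \<otimes> inv g"
    using assms by (simp only: m_assoc m_closed inv_closed nat_pow_closed)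
  thus ?case using assms Suc by (simp add: m_assoc)
qed (use assms in simp)

lemma (in group) conj_cancel:
  assumes "g \<in> carrier G" "a \<in> carrier G"
  shows "inv g \<otimes> (g \<otimes> a \<otimes> inv g) \<otimes> g = a" "g \<otimes> (inv g \<otimes> a \<otimes> g) \<otimes> inv g = a"
  using assms by (simp_all add: m_assoc) (simp_all add: m_assoc[symmetric])

lemma (in group) ord_conj:
  assumes "g \<in> carrier G" "a \<in> carrier G"
  shows "ord (g \<otimes> a \<otimes> inv g) = ord a"
proof -
  have "g \<otimes> b \<otimes> inv g = \<one> \<longleftrightarrow> b = \<one>" if "b \<in> carrier G" for b
    using that assms conj_cancel(1)[OF assms(1) that] by auto
  thus ?thesis
    using assms by (subst ord_unique) (auto simp: conj_pow pow_eq_id[symmetric])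
qed

lemma (in group) mem_generateE:
  assumes "finite (carrier G)" "x \<in> carrier G" "h \<in> generate G {x}"
  obtains k :: nat where "h = x [^] k"
  using assms generate_pow_on_finite_carrier by auto

lemma (in group) pow_mem_generate: "x \<in> carrier G \<Longrightarrow> x [^] (k::nat) \<in> generate G {x}"
  using generate_pow[of x] int_pow_int[of G x k] by (metis (mono_tags, lifting) UNIV_I mem_Collect_eq)

lemma (in group) generate_singleton_subgroup: "x \<in> carrier G \<Longrightarrow> subgroup (generate G {x}) G"
  by (simp add: generate_is_subgroup)

lemma (in group) generate_singleton_carrier: "x \<in> carrier G \<Longrightarrow> h \<in> generate G {x} \<Longrightarrow> h \<in> carrier G"
  using generate_singleton_subgroup subgroup.mem_carrier by metis

lemma (in group) generate_singleton_subset: "subgroup A G \<Longrightarrow> x \<in> A \<Longrightarrow> generate G {x} \<subseteq> A"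
  by (rule generate_subgroup_incl) auto

lemma (in group) generate_singleton_commute:
  assumes "finite (carrier G)" "x \<in> carrier G" "a \<in> generate G {x}" "b \<in> generate G {x}"
  shows "a \<otimes> b = b \<otimes> a"
proof -
  obtain k l :: nat where "a = x [^] k" "b = x [^] l" using assms mem_generateE by metis
  thus ?thesis using assms by (simp add: nat_pow_mult add.commute)
qed

lemma (in group) card_subgroup_dvd:
  assumes "subgroup C G" "subgroup A G" "C \<subseteq> A"
  shows "card C dvd card A"
proof -
  interpret A: group "G\<lparr>carrier := A\<rparr>" using subgroup_imp_group[OF assms(2)] .
  show ?thesis
    using A.lagrange[OF subgroup_incl[OF assms]] by (simp add: order_def) (metis dvd_triv_right)
qed

lemma (in group) subgroup_pow_card:
  assumes "subgroup C G" "h \<in> C"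
  shows "h [^] card C = \<one>"
proof -
  interpret C: group "G\<lparr>carrier := C\<rparr>" using subgroup_imp_group[OF assms(1)] .
  show ?thesis using C.pow_order_eq_1[of h] assms nat_pow_consistent[of h "card C" C] by (simp add: order_def)
qed

text \<open>With e = ord x / d, the equation (x^j)^e = 1 forces d to divide j. Membership in a
  subgroup of a cyclic group thus becomes an equation, and equations survive conjugation.\<close>

lemma (in group) mem_generate_pow:
  assumes "finite (carrier G)" "x \<in> carrier G" and d: "d dvd ord x"
    and h: "h \<in> generate G {x}" "h [^] (ord x div d) = \<one>"
  shows "h \<in> generate G {x [^] d}"
proof -
  obtain j :: nat where j: "h = x [^] j" using mem_generateE assms by blast
  obtain e where e: "ord x = d * e" using d by blast
  have "ord x > 0" using ord_ge_1[OF assms(1,2)] by simp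
  hence e0: "e > 0" "d > 0" using e by (auto intro: gr0I)
  have "ord x dvd j * e" using h(2) e e0 j assms(2) by (simp add: nat_pow_pow pow_eq_id)
  hence "d dvd j" using e e0 by simp
  then obtain l where "j = d * l" by blast
  hence "h = (x [^] d) [^] l" using j assms(2) by (simp add: nat_pow_pow)
  thus ?thesis using pow_mem_generate[of "x [^] d"] assms(2) by simp
qed

text \<open>A sandwich: C lies among the solutions of h^|C| = 1 in the cyclic group, these lie in
  the subgroup generated by the indicated power of x, and the two outer sets have the same
  size.\<close>

lemma (in group) cyclic_subgroup_unique:
  assumes "finite (carrier G)" "x \<in> carrier G" "subgroup C G" "C \<subseteq> generate G {x}"
  shows "card C dvd ord x" "C = generate G {x [^] (ord x div card C)}"
    "C = {h \<in> generate G {x}. h [^] card C = \<one>}"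
proof -
  show dvd: "card C dvd ord x"
    using card_subgroup_dvd[OF assms(3) generate_singleton_subgroup[OF assms(2)] assms(4)]
      generate_pow_card[OF assms(2)] by simp
  have pos: "ord x > 0" using ord_ge_1[OF assms(1,2)] by simp
  define d where "d = ord x div card C"
  have d: "d dvd ord x" "ord x div d = card C" "d \<noteq> 0"
    using dvd pos by (auto simp: d_def div_dvd_iff_mult intro!: gr0I elim!: dvdE)
  have sub: "C \<subseteq> {h \<in> generate G {x}. h [^] card C = \<one>}"
    using subgroup_pow_card[OF assms(3)] assms(4) by auto
  have sub2: "{h \<in> generate G {x}. h [^] card C = \<one>} \<subseteq> generate G {x [^] d}"
    using mem_generate_pow[OF assms(1,2) d(1)] d(2) by auto
  have "card (generate G {x [^] d}) = card C"
    using generate_pow_card[of "x [^] d"] ord_pow[OF assms(2) d(1,3)] d(2) assms(2) by simp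
  moreover have "finite (generate G {x [^] d})"
    using assms(1,2) generate_incl[of "{x [^] d}"] finite_subset by blast
  ultimately have "C = generate G {x [^] d}"
    using sub sub2 by (metis card_subset_eq subset_trans)
  thus "C = generate G {x [^] (ord x div card C)}" "C = {h \<in> generate G {x}. h [^] card C = \<one>}"
    using sub sub2 by (auto simp: d_def)
qed

text \<open>It suffices that conjugates of x^d stay in the larger group generated by x: they still
  satisfy h^(ord x / d) = 1, and this equation cuts out the smaller group.\<close>

lemma (in group) normal_generate_pow:
  assumes "finite (carrier G)" "x \<in> carrier G" and d: "d dvd ord x"
    and conj: "\<And>g. g \<in> carrier G \<Longrightarrow> g \<otimes> x [^] d \<otimes> inv g \<in> generate G {x}"
  shows "generate G {x [^] d} \<lhd> G"
  unfolding normal_inv_iff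
proof (intro conjI ballI)
  show "subgroup (generate G {x [^] d}) G" using generate_singleton_subgroup assms(2) by simp
next
  fix g h assume g: "g \<in> carrier G" and h: "h \<in> generate G {x [^] d}"
  then obtain l :: nat where l: "h = (x [^] d) [^] l" using mem_generateE assms(1,2) by blast
  let ?c = "g \<otimes> x [^] d \<otimes> inv g"
  have "(x [^] d) [^] (ord x div d) = \<one>" using d assms(2) by (simp add: nat_pow_pow)
  hence "?c [^] (ord x div d) = \<one>" using g assms(2) by (simp add: conj_pow)
  hence "?c \<in> generate G {x [^] d}" using mem_generate_pow[OF assms(1-3) conj[OF g]] by simp
  hence "generate G {?c} \<subseteq> generate G {x [^] d}"
    using generate_singleton_subset generate_singleton_subgroup assms(2) by simp
  thus "g \<otimes> h \<otimes> inv g \<in> generate G {x [^] d}"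
    using pow_mem_generate[of ?c l] g assms(2) l by (auto simp: conj_pow)
qed

text \<open>Subgroups of a cyclic group are characteristic, since C is cut out by h^|C| = 1.\<close>

lemma (in group) normal_of_subgroup_normal_cyclic:
  assumes "finite (carrier G)" "y \<in> carrier G" "generate G {y} \<lhd> G" "subgroup C G" "C \<subseteq> generate G {y}"
  shows "C \<lhd> G"
  unfolding normal_inv_iff
proof (intro conjI ballI)
  fix g h assume gh: "g \<in> carrier G" "h \<in> C"
  have C: "C = {h \<in> generate G {y}. h [^] card C = \<one>}"
    using cyclic_subgroup_unique(3)[OF assms(1,2,4,5)] .
  have "h \<in> carrier G" using gh assms(4) subgroup.mem_carrier by metis
  moreover have "h [^] card C = \<one>" "h \<in> generate G {y}" using gh C by auto
  ultimately have "g \<otimes> h \<otimes> inv g \<in> generate G {y}" "(g \<otimes> h \<otimes> inv g) [^] card C = \<one>"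
    using gh normal.inv_op_closed2[OF assms(3)] by (auto simp: conj_pow)
  thus "g \<otimes> h \<otimes> inv g \<in> C" using C by blast
qed (fact assms)

section \<open>Products and intersections of conjugate cyclic subgroups\<close>

lemma (in group) card_subgroup_product:
  assumes "finite (carrier G)" and A: "subgroup A G" and B: "subgroup B G"
  shows "card A * card B \<le> card (A <#> B) * card (A \<inter> B)"
proof -
  have sub: "A \<subseteq> carrier G" "B \<subseteq> carrier G" using A B subgroup.subset by blast+
  hence fin: "finite A" "finite B" using assms(1) finite_subset by blast+
  define m where "m = (\<lambda>(a, b). a \<otimes> b)"
  have im: "m ` (A \<times> B) = A <#> B" by (auto simp: m_def set_mult_def)
  \<comment> \<open>Given one factorisation a0 b0 of w, any other factorisation a b satisfies inv a0
    a = b0 inv b; this element lies in both subgroups and determines a, hence also b.\<close>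
  have fibre: "card {s \<in> A \<times> B. m s = w} \<le> card (A \<inter> B)" if w: "w \<in> A <#> B" for w
  proof -
    obtain a0 b0 where ab: "a0 \<in> A" "b0 \<in> B" "w = a0 \<otimes> b0" using w by (auto simp: set_mult_def)
    have key: "inv a0 \<otimes> a = b0 \<otimes> inv b" if "a \<in> A" "b \<in> B" "a \<otimes> b = w" for a b
    proof -
      have c: "a \<in> carrier G" "b \<in> carrier G" "a0 \<in> carrier G" "b0 \<in> carrier G"
        using that ab sub by auto
      have "inv a0 \<otimes> a = inv a0 \<otimes> (a \<otimes> b) \<otimes> inv b" using c by (simp add: m_assoc)
      also have "\<dots> = inv a0 \<otimes> (a0 \<otimes> b0) \<otimes> inv b" using that ab by simp
      also have "\<dots> = b0 \<otimes> inv b" using c by (simp add: m_assoc[symmetric])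
      finally show ?thesis .
    qed
    have "inj_on (\<lambda>s. inv a0 \<otimes> fst s) {s \<in> A \<times> B. m s = w}"
    proof (rule inj_onI)
      fix s t assume s: "s \<in> {s \<in> A \<times> B. m s = w}" and t: "t \<in> {s \<in> A \<times> B. m s = w}"
        and eq: "inv a0 \<otimes> fst s = inv a0 \<otimes> fst t"
      have c: "fst s \<in> carrier G" "snd s \<in> carrier G" "fst t \<in> carrier G" "snd t \<in> carrier G" "a0 \<in> carrier G"
        using s t ab sub by auto
      have fst: "fst s = fst t" using eq c by simp
      have "fst s \<otimes> snd s = fst t \<otimes> snd t" using s t by (auto simp: m_def)
      hence "snd s = snd t" using fst c by simp
      thus "s = t" using fst by (simp add: prod_eq_iff)
    qed
    moreover have "(\<lambda>s. inv a0 \<otimes> fst s) ` {s \<in> A \<times> B. m s = w} \<subseteq> A \<inter> B"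
    proof clarify
      fix a b assume h: "a \<in> A" "b \<in> B" "w = m (a, b)"
      have "inv a0 \<otimes> a \<in> A" using h ab A by (simp add: subgroup.m_closed subgroup.m_inv_closed)
      moreover have "inv a0 \<otimes> a \<in> B"
        using key[of a b] h ab B by (simp add: m_def subgroup.m_closed subgroup.m_inv_closed)
      ultimately show "inv a0 \<otimes> fst (a, b) \<in> A \<inter> B" by simp
    qed
    ultimately show ?thesis
      using card_inj_on_le[of "\<lambda>s. inv a0 \<otimes> fst s" "{s \<in> A \<times> B. m s = w}" "A \<inter> B"] fin by simp
  qed
  have "card A * card B = (\<Sum>s\<in>A \<times> B. 1)" by (simp add: card_cartesian_product)
  also have "\<dots> = (\<Sum>w\<in>m ` (A \<times> B). \<Sum>s | s \<in> A \<times> B \<and> m s = w. 1)"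
    using fin by (intro sum.image_gen) auto
  also have "\<dots> = (\<Sum>w\<in>A <#> B. card {s \<in> A \<times> B. m s = w})" by (simp add: im)
  also have "\<dots> \<le> card (A <#> B) * card (A \<inter> B)"
    using sum_bounded_above[of "A <#> B" "\<lambda>w. card {s \<in> A \<times> B. m s = w}" "card (A \<inter> B)"] fibre by simp
  finally show ?thesis .
qed

lemma (in group) card_subgroup_Int:
  assumes "finite (carrier G)" and A: "subgroup A G" and B: "subgroup B G"
  shows "card A * card B \<le> order G * card (A \<inter> B)"
proof -
  have "A <#> B \<subseteq> carrier G" using A B subgroup.subset setmult_subset_G by blast
  hence "card (A <#> B) \<le> order G" unfolding order_def using assms(1) by (intro card_mono)
  thus ?thesis using card_subgroup_product[OF assms] mult_le_mono1 le_trans by blast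
qed

lemma (in group) generate_conj:
  assumes "finite (carrier G)" "x \<in> carrier G" "g \<in> carrier G"
  shows "generate G {g \<otimes> x \<otimes> inv g} = (\<lambda>a. g \<otimes> a \<otimes> inv g) ` generate G {x}"
  using assms by (auto simp: generate_pow_on_finite_carrier conj_pow)

text \<open>Strictness comes from the product of A and its conjugate missing inv g: writing inv g =
  a g b inv g with a, b in A would put g into A, and then g would commute with x and fix A.\<close>

lemma (in group) card_conj_Int:
  assumes fin: "finite (carrier G)" and x: "x \<in> carrier G" and g: "g \<in> carrier G"
    and ne: "generate G {g \<otimes> x \<otimes> inv g} \<noteq> generate G {x}"
  shows "ord x * ord x < order G * card (generate G {x} \<inter> generate G {g \<otimes> x \<otimes> inv g})"
proof -
  let ?A = "generate G {x}" and ?B = "generate G {g \<otimes> x \<otimes> inv g}"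
  have gx: "g \<otimes> x \<otimes> inv g \<in> carrier G" using x g by simp
  have A: "subgroup ?A G" and B: "subgroup ?B G"
    using generate_singleton_subgroup x gx by auto
  have notA: "g \<notin> ?A"
  proof
    assume gA: "g \<in> ?A"
    have "g \<otimes> x \<otimes> inv g = x \<otimes> g \<otimes> inv g"
      using generate_singleton_commute[OF fin x gA generate.incl] by simp
    also have "\<dots> = x" using x g by (simp add: m_assoc)
    finally show False using ne by simp
  qed
  have notin: "inv g \<notin> ?A <#> ?B"
  proof
    assume "inv g \<in> ?A <#> ?B"
    then obtain a b where ab: "a \<in> ?A" "b \<in> ?A" "inv g = a \<otimes> (g \<otimes> b \<otimes> inv g)"
      using generate_conj[OF fin x g] by (auto simp: set_mult_def)
    have c: "a \<in> carrier G" "b \<in> carrier G" using ab A subgroup.mem_carrier by metis+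
    have "inv g \<otimes> g = a \<otimes> (g \<otimes> b \<otimes> inv g) \<otimes> g" using ab(3) by simp
    hence "a \<otimes> (g \<otimes> b) = \<one>" using c g by (simp add: m_assoc)
    hence "g \<otimes> b = inv a" using c g by (metis inv_equality inv_inv m_closed inv_comm)
    hence "g = inv a \<otimes> inv b" using c g by (metis inv_solve_right inv_closed)
    thus False using notA ab A by (simp add: subgroup.m_closed subgroup.m_inv_closed)
  qed
  have "?A <#> ?B \<subseteq> carrier G" using A B subgroup.subset setmult_subset_G by blast
  hence "?A <#> ?B \<subset> carrier G" using notin g by blast
  hence lt: "card (?A <#> ?B) < order G" unfolding order_def using fin by (intro psubset_card_mono)
  have "finite (?A \<inter> ?B)" using finite_subset[OF subgroup.subset[OF A] fin] by simp
  moreover have "\<one> \<in> ?A \<inter> ?B" by (simp add: generate.one)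
  ultimately have pos: "card (?A \<inter> ?B) > 0" by (metis card_gt_0_iff empty_iff)
  have "ord x * ord x \<le> card (?A <#> ?B) * card (?A \<inter> ?B)"
    using card_subgroup_product[OF fin A B] generate_pow_card x gx ord_conj[OF g x] by simp
  also have "\<dots> < order G * card (?A \<inter> ?B)" using lt pos by simp
  finally show ?thesis .
qed

text \<open>As i is prime to p, ord x contains the full p-part of the group order. The index of A
  \<inter> A^g in A is at most i, hence also below p, so the intersection keeps that p-part. A
  conjugate of the Sylow generator has order p^a and lies in the cyclic group A^g, hence in the
  intersection.\<close>

lemma (in group) normal_cyclic_sylow:
  assumes fin: "finite (carrier G)" and x: "x \<in> carrier G" and p: "prime p" "p dvd order G"
    and i: "order G = i * ord x" "i < p"
  obtains y a m where "order G = p ^ a * m" "\<not> p dvd m" "m > 0" "a > 0" "y \<in> carrier G"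
    "ord y = p ^ a" "generate G {y} \<lhd> G"
proof -
  have pos: "order G > 0" using fin order_gt_0_iff_finite by simp
  then obtain a m where am: "order G = p ^ a * m" "\<not> p dvd m" "m > 0"
    using prime_power_decomp p(1) by blast
  have a: "a > 0" using am p(2) by (cases a) auto
  have cop: "coprime (p ^ a) j" if "0 < j" "j < p" for j
    using that p(1) by (metis coprime_power_left_iff nat_dvd_not_less prime_imp_coprime)
  have "i > 0" using i pos by (auto intro: gr0I)
  hence dvd: "p ^ a dvd ord x" 
    using cop[of i] i am(1) by (metis coprime_dvd_mult_right_iff dvd_triv_left)
  define d where "d = ord x div p ^ a"
  have N0: "ord x > 0" using ord_ge_1[OF fin x] by simp
  have d: "d dvd ord x" "ord x div d = p ^ a" "d \<noteq> 0"
    using dvd N0 by (auto simp: d_def div_dvd_iff_mult intro!: gr0I elim!: dvdE)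
  let ?y = "x [^] d"
  have y: "?y \<in> carrier G" "ord ?y = p ^ a" using ord_pow[OF x d(1,3)] d(2) x by auto
  have "g \<otimes> ?y \<otimes> inv g \<in> generate G {x}" if g: "g \<in> carrier G" for g
  proof -
    let ?x = "g \<otimes> x \<otimes> inv g"
    let ?C = "generate G {x} \<inter> generate G {?x}"
    have gx: "?x \<in> carrier G" using g x by simp
    have A: "subgroup (generate G {x}) G" and B: "subgroup (generate G {?x}) G"
      using generate_singleton_subgroup x gx by auto
    have C: "subgroup ?C G" using A B subgroup_Int by blast
    have "card ?C dvd ord x" using cyclic_subgroup_unique(1)[OF fin x C] by simp
    then obtain t where t: "ord x = card ?C * t" by blast
    have cp: "card ?C > 0" "t > 0" using t N0 by (auto intro: gr0I)
    have "ord x * ord x \<le> i * ord x * card ?C"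
      using card_subgroup_Int[OF fin A B] generate_pow_card x gx ord_conj[OF g x] i(1) by simp
    hence "ord x \<le> i * card ?C" using N0 by (simp add: mult.commute mult.left_commute)
    hence "t \<le> i" using t cp by (simp add: mult.commute)
    hence "coprime (p ^ a) t" using cop[of t] cp(2) i(2) by simp
    hence "p ^ a dvd card ?C" using dvd t by (simp add: coprime_dvd_mult_left_iff)
    moreover have c: "g \<otimes> ?y \<otimes> inv g \<in> carrier G" using g y by simp
    moreover have "ord (g \<otimes> ?y \<otimes> inv g) = p ^ a" using ord_conj[OF g y(1)] y(2) by simp
    ultimately have "(g \<otimes> ?y \<otimes> inv g) [^] card ?C = \<one>" by (simp add: pow_eq_id)
    moreover have "g \<otimes> ?y \<otimes> inv g \<in> generate G {?x}"
      using pow_mem_generate[OF gx, of d] g x by (simp add: conj_pow)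
    ultimately have "g \<otimes> ?y \<otimes> inv g \<in> ?C"
      using cyclic_subgroup_unique(3)[OF fin gx C] by blast
    thus ?thesis by blast
  qed
  hence "generate G {?y} \<lhd> G" using normal_generate_pow[OF fin x d(1)] by blast
  with am a y show thesis using that by blast
qed

text \<open>On each coset of the kernel, ord (g0 u) <= m ord u, where m is the order of the image in
  H and g0 is a representative with g0^m = 1. Summing over u gives m times f of the kernel
  order.\<close>

lemma (in group_hom) psi_le_of_coprime_cyclic_kernel:
  assumes fin: "finite (carrier G)" and y: "y \<in> carrier G" and surj: "h ` carrier G = carrier H"
    and ker: "kernel G H h = generate G {y}" and cop: "coprime (G.ord y) (order H)"
  shows "psi G \<le> cyclic_order_sum (G.ord y) * psi H"
proof -
  have finH: "finite (carrier H)" using surj fin by (metis finite_imageI)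
  let ?K = "generate G {y}"
  have K: "?K \<lhd> G" using normal_kernel ker by simp
  have KG: "?K \<subseteq> carrier G" using K normal_imp_subgroup subgroup.subset by blast
  have fibre: "(\<Sum>g | g \<in> carrier G \<and> h g = q. G.ord g) \<le> cyclic_order_sum (G.ord y) * H.ord q"
    if q: "q \<in> carrier H" for q
  proof -
    define m where "m = H.ord q"
    obtain g1 where g1: "g1 \<in> carrier G" "h g1 = q" using surj q by (metis imageE)
    have m0: "m > 0" unfolding m_def using H.ord_ge_1[OF finH q] by simp
    have "coprime (G.ord y) m"
      using cop H.ord_dvd_group_order[OF q] unfolding m_def by (metis coprime_divisors dvd_refl)
    \<comment> \<open>The exponent ord y * s is 1 modulo m, so g0 still maps to q. It is also a
      multiple of the kernel order, so it kills g1^m and gives g0^m = 1.\<close>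
    then obtain s where s: "[G.ord y * s = Suc 0] (mod m)" using cong_solve_coprime_nat by blast
    define g0 where "g0 = g1 [^] (G.ord y * s)"
    have g0: "g0 \<in> carrier G" using g1 by (simp add: g0_def)
    have hg0: "h g0 = q"
    proof -
      have "h g0 = q [^]\<^bsub>H\<^esub> (G.ord y * s)" using g1 by (simp add: g0_def hom_nat_pow)
      also have "\<dots> = q [^]\<^bsub>H\<^esub> (1::nat)"
      proof -
        have "[int 1 = int (G.ord y * s)] (mod int m)" using s cong_sym by (simp only: cong_int_iff) simp
        hence "int m dvd 1 - int (G.ord y * s)" by (simp only: cong_iff_dvd_diff) simp
        thus ?thesis using H.int_pow_eq[OF q, of "int (G.ord y * s)" "int 1"]
          unfolding m_def int_pow_int by simp
      qed
      finally show ?thesis using q by simp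
    qed
    have g0m: "g0 [^] m = \<one>"
    proof -
      have "g1 [^] m \<in> ?K" unfolding ker[symmetric] kernel_def
        using g1 q H.pow_ord_eq_1[OF q] by (simp add: hom_nat_pow m_def)
      hence "(g1 [^] m) [^] G.ord y = \<one>"
        using G.subgroup_pow_card[OF G.generate_singleton_subgroup[OF y]] G.generate_pow_card[OF y] by simp
      hence "((g1 [^] m) [^] G.ord y) [^] s = \<one>" by simp
      thus ?thesis using g1 by (simp add: g0_def G.nat_pow_pow mult_ac)
    qed
    have fib: "{g \<in> carrier G. h g = q} = (\<lambda>u. g0 \<otimes> u) ` ?K"
    proof (intro equalityI subsetI)
      fix g assume g: "g \<in> {g \<in> carrier G. h g = q}"
      hence "inv g0 \<otimes> g \<in> ?K" unfolding ker[symmetric] kernel_def using g0 hg0 q by simp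
      moreover have "g = g0 \<otimes> (inv g0 \<otimes> g)" using g g0 by (simp add: G.m_assoc[symmetric])
      ultimately show "g \<in> (\<lambda>u. g0 \<otimes> u) ` ?K" by blast
    next
      fix g assume "g \<in> (\<lambda>u. g0 \<otimes> u) ` ?K"
      thus "g \<in> {g \<in> carrier G. h g = q}"
        using g0 hg0 q unfolding ker[symmetric] kernel_def by auto
    qed
    have le: "G.ord (g0 \<otimes> u) \<le> m * G.ord u" if u: "u \<in> ?K" for u
    proof -
      have uG: "u \<in> carrier G" using u KG by blast
      have U: "generate G {u} \<lhd> G"
        using G.normal_of_subgroup_normal_cyclic[OF fin y K G.generate_singleton_subgroup[OF uG]]
          G.generate_singleton_subset[OF G.generate_singleton_subgroup[OF y] u] by blast
      \<comment> \<open>The group generated by u is normal in G, so the j-th power of g0 u stays in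
        the coset of g0^j modulo that group; at j = m only an element of that group is left.\<close>
      have "\<exists>v\<in>generate G {u}. (g0 \<otimes> u) [^] j = g0 [^] j \<otimes> v" for j :: nat
      proof (induction j)
        case 0
        show ?case by (rule bexI[of _ \<one>]) (simp_all add: generate.one)
      next
        case (Suc j)
        then obtain v where v: "v \<in> generate G {u}" "(g0 \<otimes> u) [^] j = g0 [^] j \<otimes> v" by blast
        have vG: "v \<in> carrier G" using v G.generate_singleton_carrier uG by blast
        have "inv g0 \<otimes> v \<otimes> g0 \<otimes> u \<in> generate G {u}"
          using normal.inv_op_closed1[OF U g0 v(1)] generate.incl[of u "{u}" G]
            subgroup.m_closed[OF G.generate_singleton_subgroup[OF uG]] by blast
        moreover have "(g0 \<otimes> u) [^] Suc j = g0 [^] Suc j \<otimes> (inv g0 \<otimes> v \<otimes> g0 \<otimes> u)"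
        proof -
          have "g0 [^] Suc j \<otimes> (inv g0 \<otimes> v \<otimes> g0 \<otimes> u) = g0 [^] j \<otimes> (g0 \<otimes> inv g0) \<otimes> v \<otimes> g0 \<otimes> u"
            using g0 vG uG by (simp only: G.nat_pow_Suc G.m_assoc G.m_closed G.inv_closed G.nat_pow_closed)
          also have "\<dots> = (g0 \<otimes> u) [^] Suc j" using v(2) g0 vG uG by (simp add: G.m_assoc)
          finally show ?thesis ..
        qed
        ultimately show ?case by blast
      qed
      then obtain v where v: "v \<in> generate G {u}" "(g0 \<otimes> u) [^] m = g0 [^] m \<otimes> v" by blast
      have vG: "v \<in> carrier G" using v G.generate_singleton_carrier uG by blast
      have "v [^] G.ord u = \<one>"
        using G.subgroup_pow_card[OF G.generate_singleton_subgroup[OF uG] v(1)] G.generate_pow_card[OF uG] by simp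
      hence "((g0 \<otimes> u) [^] m) [^] G.ord u = \<one>" using v(2) g0m vG by simp
      hence "G.ord (g0 \<otimes> u) dvd m * G.ord u" using g0 uG by (simp add: G.nat_pow_pow G.pow_eq_id)
      thus ?thesis using m0 G.ord_ge_1[OF fin uG] by (intro dvd_imp_le) auto
    qed
    have inj: "inj_on (\<lambda>u. g0 \<otimes> u) ?K" using g0 KG by (intro inj_onI) (metis G.l_cancel subsetD)
    have "(\<Sum>g | g \<in> carrier G \<and> h g = q. G.ord g) = (\<Sum>u\<in>?K. G.ord (g0 \<otimes> u))"
      unfolding fib using inj by (simp add: sum.reindex)
    also have "\<dots> \<le> (\<Sum>u\<in>?K. m * G.ord u)" by (intro sum_mono le)
    also have "\<dots> = m * cyclic_order_sum (G.ord y)"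
      using G.sum_ord_generate[OF fin y] by (simp add: sum_distrib_left[symmetric])
    finally show ?thesis by (simp add: m_def mult.commute)
  qed
  have "psi G = (\<Sum>q\<in>carrier H. \<Sum>g | g \<in> carrier G \<and> h g = q. G.ord g)"
    unfolding psi_def using fin finH surj by (intro sum.group[symmetric]) auto
  also have "\<dots> \<le> (\<Sum>q\<in>carrier H. cyclic_order_sum (G.ord y) * H.ord q)" by (intro sum_mono fibre)
  also have "\<dots> = cyclic_order_sum (G.ord y) * psi H" by (simp add: psi_def sum_distrib_left)
  finally show ?thesis .
qed

section \<open>Groups of prime power order and cyclic subgroups of prime index\<close>

text \<open>The class equation: without a nontrivial central element every conjugacy class other
  than {1} has size divisible by p, so p would divide both p^a and p^a - 1.\<close>

lemma (in group) prime_power_order_center: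
  assumes p: "prime p" and ord: "order G = p ^ a" "a > 0"
  obtains z where "z \<in> carrier G" "z \<noteq> \<one>" "\<And>g. g \<in> carrier G \<Longrightarrow> g \<otimes> z = z \<otimes> g"
proof -
  have "\<exists>z\<in>carrier G. z \<noteq> \<one> \<and> (\<forall>g\<in>carrier G. g \<otimes> z = z \<otimes> g)"
  proof (rule ccontr)
    assume no: "\<not> ?thesis"
    have fin: "finite (carrier G)" using ord p order_gt_0_iff_finite prime_gt_0_nat by simp
    define \<phi> where "\<phi> = (\<lambda>g. \<lambda>h\<in>carrier G. g \<otimes> h \<otimes> inv g)"
    interpret act: group_action G "carrier G" \<phi> unfolding \<phi>_def by (rule action_by_conjugation)
    have orbit: "orbit G \<phi> h = {g \<otimes> h \<otimes> inv g | g. g \<in> carrier G}" if "h \<in> carrier G" for h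
      using that by (auto simp: orbit_def \<phi>_def)
    let ?O = "orbits G (carrier G) \<phi>"
    have finO: "finite ?O" using fin by (simp add: orbits_def)
    have one: "orbit G \<phi> \<one> = {\<one>}"
      unfolding orbit[OF one_closed] by auto (metis inv_one l_one one_closed)
    have oneO: "{\<one>} \<in> ?O" using one by (auto simp: orbits_def)
    have dvd: "p dvd card C" if C: "C \<in> ?O - {{\<one>}}" for C
    proof -
      obtain h where h: "h \<in> carrier G" "C = orbit G \<phi> h" using C by (auto simp: orbits_def)
      have "h \<noteq> \<one>" using C h one by auto
      then obtain g where g: "g \<in> carrier G" "g \<otimes> h \<noteq> h \<otimes> g" using no h by blast
      have hC: "h \<in> C" "g \<otimes> h \<otimes> inv g \<in> C"
        using act.orbit_refl[OF h(1)] h(2) g(1) orbit[OF h(1)] by blast+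
      have "g \<otimes> h \<otimes> inv g \<noteq> h" using g h by (metis inv_solve_right m_closed)
      hence "card C \<noteq> 1" using hC by (auto simp: card_1_singleton_iff)
      moreover have "card C dvd p ^ a"
        using act.orbit_stabilizer_theorem[OF h(1)] ord(1) h(2) by (metis dvd_triv_left)
      ultimately show ?thesis
        using p by (metis divides_primepow_nat dvd_power gr0I power_0)
    qed
    have "p ^ a = (\<Sum>C\<in>?O. \<Sum>x\<in>C. 1)"
      using act.disjoint_sum[OF fin, of "\<lambda>_. 1::nat"] ord by (simp add: order_def)
    also have "\<dots> = card {\<one>} + (\<Sum>C\<in>?O - {{\<one>}}. card C)"
      using sum.remove[OF finO oneO, of card] by simp
    finally have "p ^ a = 1 + (\<Sum>C\<in>?O - {{\<one>}}. card C)" by simp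
    moreover have "p dvd (\<Sum>C\<in>?O - {{\<one>}}. card C)" using dvd by (rule dvd_sum)
    moreover have "p dvd p ^ a" using ord(2) by simp
    ultimately have "p dvd 1" by (metis dvd_add_left_iff)
    thus False using p by simp
  qed
  thus thesis using that by blast
qed

text \<open>The quotient handed to the hypothesis has the element type of G, so an induction
  hypothesis over \<open>'a monoid\<close> applies to it.\<close>

lemma (in group) supersolvable_of_quotient:
  assumes "N \<lhd> G" "super_chain G N"
    and Q: "\<And>(Q :: 'a monoid) f. group_hom G Q f \<Longrightarrow> f ` carrier G = carrier Q \<Longrightarrow> kernel G Q f = N \<Longrightarrow>
      order Q * card N = order G \<Longrightarrow> supersolvable Q"
  shows "supersolvable G"
proof -
  obtain Q :: "'a monoid" and f where f: "group_hom G Q f" "f ` carrier G = carrier Q" "kernel G Q f = N"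
    "order Q * card N = order G"
    using normal.quotient_exists[OF assms(1)] by blast
  show ?thesis
    using group_hom.supersolvable_preimage[OF f(1,2)] f(3) assms(2) Q[OF f] by simp
qed

lemma supersolvable_prime_power_order:
  fixes G :: "('a, 'b) monoid_scheme"
  assumes "group G" and p: "prime p" and "order G = p ^ a"
  shows "supersolvable G"
proof -
  \<comment> \<open>The induction lives on plain monoids, the type of the quotients; the given G
    enters at the end through its quotient by the trivial subgroup.\<close>
  have mon: "supersolvable Q" if "group Q" "order Q = p ^ b" for Q :: "'a monoid" and b
    using that
  proof (induction b arbitrary: Q rule: less_induct)
    case (less b)
    interpret Q: group Q by fact
    have fin: "finite (carrier Q)" using less.prems p Q.order_gt_0_iff_finite prime_gt_0_nat by simp
    show ?case
    proof (cases "b = 0")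
      case True
      hence "carrier Q = {\<one>\<^bsub>Q\<^esub>}" using less.prems Q.order_one_triv_iff by simp
      thus ?thesis using Q.supersolvable_iff super_chain.base[of Q] by simp
    next
      case False
      then obtain z where z: "z \<in> carrier Q" "z \<noteq> \<one>\<^bsub>Q\<^esub>"
        "\<And>g. g \<in> carrier Q \<Longrightarrow> g \<otimes>\<^bsub>Q\<^esub> z = z \<otimes>\<^bsub>Q\<^esub> g"
        using Q.prime_power_order_center[OF p less.prems(2)] by auto
      have "g \<otimes>\<^bsub>Q\<^esub> z [^]\<^bsub>Q\<^esub> (1::nat) \<otimes>\<^bsub>Q\<^esub> inv\<^bsub>Q\<^esub> g \<in> generate Q {z}" if "g \<in> carrier Q" for g
        using that z generate.incl[of z "{z}" Q] by (simp add: Q.m_assoc)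
      hence N: "generate Q {z} \<lhd> Q"
        using Q.normal_generate_pow[OF fin z(1), of 1] z(1) by simp
      show ?thesis
      proof (rule Q.supersolvable_of_quotient[OF N Q.super_chain_generate[OF z(1) N]])
        fix R :: "'a monoid" and f
        assume R: "group_hom Q R f" "order R * card (generate Q {z}) = order Q"
        have "order R dvd p ^ b" using R(2) less.prems(2) by (metis dvd_triv_left)
        then obtain c where c: "c \<le> b" "order R = p ^ c" using p divides_primepow_nat by blast
        have "card (generate Q {z}) \<noteq> 1"
          using Q.generate_pow_card[OF z(1)] Q.ord_eq_1[OF z(1)] z(2) by simp
        hence "c \<noteq> b" using R(2) less.prems(2) c p prime_gt_0_nat by auto
        thus "supersolvable R" using less.IH[of c R] c R(1) by (simp add: group_hom_def)
      qed
    qed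
  qed
  interpret group G by fact
  show ?thesis
  proof (rule supersolvable_of_quotient[OF one_is_normal super_chain.base])
    fix Q :: "'a monoid" and f
    assume "group_hom G Q f" "order Q * card {\<one>\<^bsub>G\<^esub>} = order G"
    thus "supersolvable Q" using mon[of Q a] assms(3) by (simp add: group_hom_def)
  qed
qed

text \<open>Two different conjugates of a subgroup P of prime order m would force m^2 <= m d,
  against d < m, so P is normal. P and the cyclic group of order d have coprime orders, hence
  multiply to all of G, and c generates G modulo P.\<close>

lemma (in group) supersolvable_order_prime_mult:
  assumes fin: "finite (carrier G)" and m: "prime m" and "order G = m * d" "d < m" and c: "c \<in> carrier G" "ord c = d"
  shows "supersolvable G"
proof -
  have d0: "d > 0" using ord_ge_1[OF fin c(1)] c(2) by simp
  have m1: "m > 1" using m prime_gt_1_nat by blast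
  obtain P where P: "subgroup P G" "card P = m"
    using sylow_thm[OF m is_group, of 1 d] assms(3) fin by auto
  have finP: "finite P" using finite_subset[OF subgroup.subset[OF P(1)] fin] .
  have "P \<noteq> {\<one>}" using P(2) m1 by auto
  then obtain y where y: "y \<in> P" "y \<noteq> \<one>" using subgroup.one_closed[OF P(1)] by blast
  have yG: "y \<in> carrier G" using y(1) P(1) subgroup.mem_carrier by metis
  have "ord y dvd m" using subgroup_pow_card[OF P(1) y(1)] P(2) pow_eq_id[OF yG] by simp
  hence ordy: "ord y = m" using m y(2) ord_eq_1[OF yG] by (metis One_nat_def prime_nat_iff)
  let ?P = "generate G {y}" and ?C = "generate G {c}"
  have subP: "subgroup ?P G" and subC: "subgroup ?C G" using generate_singleton_subgroup yG c by auto
  have conj: "g \<otimes> y \<otimes> inv g \<in> ?P" if g: "g \<in> carrier G" for g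
  proof -
    let ?B = "generate G {g \<otimes> y \<otimes> inv g}"
    have gy: "g \<otimes> y \<otimes> inv g \<in> carrier G" using g yG by simp
    have subB: "subgroup ?B G" using generate_singleton_subgroup[OF gy] .
    have "m * m \<le> m * d * card (?P \<inter> ?B)"
      using card_subgroup_Int[OF fin subP subB] generate_pow_card yG gy ord_conj[OF g yG] ordy assms(3) by simp
    hence "m \<le> d * card (?P \<inter> ?B)" using m1 by simp
    hence "card (?P \<inter> ?B) \<noteq> 1" using assms(4) by auto
    moreover have "card (?P \<inter> ?B) dvd m"
      using cyclic_subgroup_unique(1)[OF fin yG subgroup_Int[OF subP subB]] ordy by simp
    ultimately have "card (?P \<inter> ?B) = card ?B"
      using m ordy ord_conj[OF g yG] generate_pow_card[OF gy] by (metis prime_nat_iff)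
    hence "?P \<inter> ?B = ?B"
      using finite_subset[OF subgroup.subset[OF subB] fin] by (metis card_subset_eq inf_le2)
    moreover have "g \<otimes> y \<otimes> inv g \<in> ?B" by (simp add: generate.incl)
    ultimately show ?thesis by blast
  qed
  have N: "?P \<lhd> G" using normal_generate_pow[OF fin yG, of 1] conj yG by simp
  have "card (?P \<inter> ?C) dvd m" "card (?P \<inter> ?C) dvd d"
    using cyclic_subgroup_unique(1)[OF fin yG subgroup_Int[OF subP subC]]
      cyclic_subgroup_unique(1)[OF fin c(1) subgroup_Int[OF subP subC]] ordy c(2) by auto
  hence "card (?P \<inter> ?C) = 1"
    using m assms(4) d0 by (metis nat_dvd_not_less prime_nat_iff)
  hence "order G \<le> card (?P <#> ?C)"
    using card_subgroup_product[OF fin subP subC] generate_pow_card yG c ordy assms(3) by simp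
  hence all: "?P <#> ?C = carrier G"
    using setmult_subset_G[OF subgroup.subset[OF subP] subgroup.subset[OF subC]] fin
    unfolding order_def by (metis card_seteq)
  have "cyclic_step G ?P (carrier G)" unfolding cyclic_step_def
  proof (intro bexI[of _ c] ballI)
    fix w assume "w \<in> carrier G"
    then obtain u v where uv: "u \<in> ?P" "v \<in> ?C" "w = u \<otimes> v" using all unfolding set_mult_def by blast
    obtain n :: int where n: "v = c [^] n" using uv generate_pow[OF c(1)] by auto
    have "w \<otimes> c [^] (- n) = u"
      using uv n c(1) subgroup.mem_carrier[OF subP] by (simp add: int_pow_neg m_assoc)
    thus "\<exists>n::int. w \<otimes> c [^] n \<in> ?P" using uv(1) by (intro exI[of _ "- n"]) simp
  qed (fact c)
  hence "super_chain G (carrier G)"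
    using super_chain.step[OF super_chain_generate[OF yG N] subgroup.subset[OF subP] normal_self] by simp
  thus ?thesis using supersolvable_iff by simp
qed

section \<open>Maximal cyclic subgroups and prime index\<close>

lemma (in group) centralizer_subgroup:
  assumes "C \<subseteq> carrier G"
  shows "subgroup {h \<in> carrier G. \<forall>c\<in>C. h \<otimes> c = c \<otimes> h} G"
proof (rule subgroupI)
  fix a assume a: "a \<in> {h \<in> carrier G. \<forall>c\<in>C. h \<otimes> c = c \<otimes> h}"
  have "inv a \<otimes> c = c \<otimes> inv a" if "c \<in> C" for c
  proof -
    have c: "c \<in> carrier G" "a \<in> carrier G" "a \<otimes> c = c \<otimes> a" using that a assms by auto
    have "inv a \<otimes> c = inv a \<otimes> (c \<otimes> a) \<otimes> inv a" using c(1,2) by (simp add: m_assoc)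
    also have "\<dots> = inv a \<otimes> (a \<otimes> c) \<otimes> inv a" using c(3) by simp
    also have "\<dots> = c \<otimes> inv a" using c(1,2) by (simp add: m_assoc[symmetric])
    finally show ?thesis .
  qed
  thus "inv a \<in> {h \<in> carrier G. \<forall>c\<in>C. h \<otimes> c = c \<otimes> h}" using a by auto
next
  fix a b assume a: "a \<in> {h \<in> carrier G. \<forall>c\<in>C. h \<otimes> c = c \<otimes> h}" and b: "b \<in> {h \<in> carrier G. \<forall>c\<in>C. h \<otimes> c = c \<otimes> h}"
  have "a \<otimes> b \<otimes> c = c \<otimes> (a \<otimes> b)" if "c \<in> C" for c
  proof -
    have c: "c \<in> carrier G" "a \<in> carrier G" "b \<in> carrier G" "a \<otimes> c = c \<otimes> a" "b \<otimes> c = c \<otimes> b"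
      using that a b assms by auto
    have "a \<otimes> b \<otimes> c = a \<otimes> c \<otimes> b" using c(1-3,5) by (simp add: m_assoc)
    also have "\<dots> = c \<otimes> a \<otimes> b" using c(4) by simp
    finally show ?thesis using c(1-3) by (simp add: m_assoc)
  qed
  thus "a \<otimes> b \<in> {h \<in> carrier G. \<forall>c\<in>C. h \<otimes> c = c \<otimes> h}" using a b by auto
next
  have "\<one> \<in> {h \<in> carrier G. \<forall>c\<in>C. h \<otimes> c = c \<otimes> h}" using assms by auto
  thus "{h \<in> carrier G. \<forall>c\<in>C. h \<otimes> c = c \<otimes> h} \<noteq> {}" by blast
qed auto

text \<open>The centralizer of the intersection contains both abelian groups A and A^g, hence is all of G
  when A is maximal.\<close>

lemma (in group) Int_conj_maximal_cyclic_central: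
  assumes fin: "finite (carrier G)" and x: "x \<in> carrier G" and g: "g \<in> carrier G"
    and max: "\<And>M. subgroup M G \<Longrightarrow> generate G {x} \<subseteq> M \<Longrightarrow> M = generate G {x} \<or> M = carrier G"
    and ne: "generate G {g \<otimes> x \<otimes> inv g} \<noteq> generate G {x}"
    and c: "c \<in> generate G {x} \<inter> generate G {g \<otimes> x \<otimes> inv g}" and h: "h \<in> carrier G"
  shows "h \<otimes> c = c \<otimes> h"
proof -
  let ?A = "generate G {x}" and ?B = "generate G {g \<otimes> x \<otimes> inv g}"
  let ?Z = "{h \<in> carrier G. \<forall>c\<in>?A \<inter> ?B. h \<otimes> c = c \<otimes> h}"
  have gx: "g \<otimes> x \<otimes> inv g \<in> carrier G" using g x by simp
  have sub: "?A \<subseteq> carrier G" "?B \<subseteq> carrier G"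
    using generate_singleton_carrier x gx by auto
  have A: "?A \<subseteq> ?Z" using generate_singleton_commute[OF fin x] sub by auto
  have B: "?B \<subseteq> ?Z" using generate_singleton_commute[OF fin gx] sub by auto
  have "?Z \<noteq> ?A"
  proof
    assume "?Z = ?A"
    hence "?B \<subseteq> ?A" using B by simp
    moreover have "card ?B = card ?A" using generate_pow_card x gx ord_conj[OF g x] by metis
    moreover have "finite ?A" using finite_subset[OF sub(1) fin] .
    ultimately show False using ne by (metis card_subset_eq)
  qed
  moreover have "subgroup ?Z G" by (rule centralizer_subgroup) (use sub in auto)
  ultimately have "?Z = carrier G" using max[of ?Z] A by blast
  thus ?thesis using c h by blast
qed

lemma (in group) not_normal_generate:
  assumes fin: "finite (carrier G)" and x: "x \<in> carrier G" and "\<not> generate G {x} \<lhd> G"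
  obtains g where "g \<in> carrier G" "g \<otimes> x \<otimes> inv g \<notin> generate G {x}"
  using normal_generate_pow[OF fin x, of 1] assms(3) x by auto

lemma (in group) central_subgroup_normal:
  assumes "subgroup C G" "\<And>c h. c \<in> C \<Longrightarrow> h \<in> carrier G \<Longrightarrow> h \<otimes> c = c \<otimes> h"
  shows "C \<lhd> G"
  unfolding normal_inv_iff
proof (intro conjI ballI)
  fix h c assume h: "h \<in> carrier G" and c: "c \<in> C"
  hence "h \<otimes> c \<otimes> inv h = c"
    using assms(2)[OF c h] subgroup.mem_carrier[OF assms(1) c] by (simp add: m_assoc)
  thus "h \<otimes> c \<otimes> inv h \<in> C" using c by simp
qed (fact assms)

lemma (in group) supersolvable_prime_index:
  assumes fin: "finite (carrier G)" and x: "x \<in> carrier G" and m: "prime m" and ord: "order G = m * ord x"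
  shows "supersolvable G"
proof (cases "generate G {x} \<lhd> G")
  case True
  show ?thesis
  proof (rule supersolvable_of_quotient[OF True super_chain_generate[OF x True]])
    fix Q :: "'a monoid" and f
    assume Q: "group_hom G Q f" "order Q * card (generate G {x}) = order G"
    hence "order Q = m ^ 1" using ord generate_pow_card[OF x] ord_ge_1[OF fin x] by simp
    thus "supersolvable Q" using supersolvable_prime_power_order m Q(1) by (metis group_hom_def)
  qed
next
  case False
  then obtain g where g: "g \<in> carrier G" "g \<otimes> x \<otimes> inv g \<notin> generate G {x}"
    using not_normal_generate[OF fin x] by blast
  let ?A = "generate G {x}" and ?B = "generate G {g \<otimes> x \<otimes> inv g}"
  let ?C = "?A \<inter> ?B"
  have gx: "g \<otimes> x \<otimes> inv g \<in> carrier G" using g x by simp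
  have N0: "ord x > 0" using ord_ge_1[OF fin x] by simp
  have A: "subgroup ?A G" and B: "subgroup ?B G" using generate_singleton_subgroup x gx by auto
  have C: "subgroup ?C G" using subgroup_Int[OF A B] .
  have ne: "?B \<noteq> ?A" using g(2) generate.incl[of "g \<otimes> x \<otimes> inv g" "{g \<otimes> x \<otimes> inv g}" G] by auto
  have max: "M = ?A \<or> M = carrier G" if M: "subgroup M G" "?A \<subseteq> M" for M
  proof -
    have finM: "finite M" using finite_subset[OF subgroup.subset[OF M(1)] fin] .
    have "ord x dvd card M" using card_subgroup_dvd[OF A M(1,2)] generate_pow_card[OF x] by simp
    then obtain t where t: "card M = ord x * t" by blast
    have "card M dvd m * ord x"
      using card_subgroup_dvd[OF M(1) subgroup_self subgroup.subset[OF M(1)]] ord by (simp add: order_def)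
    hence "t dvd m" using t N0 by (simp add: mult.commute)
    hence "t = 1 \<or> t = m" using m by (simp add: prime_nat_iff)
    thus ?thesis
    proof
      assume "t = 1"
      thus ?thesis using card_subset_eq[OF finM M(2)] t generate_pow_card[OF x] by simp
    next
      assume "t = m"
      thus ?thesis using card_subset_eq[OF fin subgroup.subset[OF M(1)]] t ord by (simp add: order_def mult.commute)
    qed
  qed
  have N: "?C \<lhd> G"
    using central_subgroup_normal[OF C] Int_conj_maximal_cyclic_central[OF fin x g(1) max ne] by blast
  obtain d where d: "ord x = card ?C * d" using cyclic_subgroup_unique(1)[OF fin x C] by auto
  have cp: "card ?C > 0" "d > 0" using d N0 by (auto intro: gr0I)
  \<comment> \<open>With d the index of the central intersection in A, the strict product estimate
    reads d < m, the condition under which a quotient of order m d was treated above.\<close>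
  have "ord x * ord x < m * ord x * card ?C" using card_conj_Int[OF fin x g(1) ne] ord by simp
  hence dm: "d < m" using d N0 by (simp add: mult.commute mult.left_commute)
  have Cgen: "?C = generate G {x [^] d}" using cyclic_subgroup_unique(2)[OF fin x C] d cp by simp
  show ?thesis
  proof (rule supersolvable_of_quotient[OF N])
    show "super_chain G ?C" using super_chain_generate[of "x [^] d"] N Cgen x by simp
  next
    fix Q :: "'a monoid" and f
    assume Q: "group_hom G Q f" "f ` carrier G = carrier Q" "kernel G Q f = ?C" "order Q * card ?C = order G"
    interpret f: group_hom G Q f by fact
    have ordQ: "order Q = m * d" using Q(4) ord d cp by simp
    \<comment> \<open>The n-th power of f x is trivial exactly when x^n lies in C, that is, when
      x^(n |C|) = 1.\<close>
    have "f.H.ord (f x) = d"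
    proof -
      have "f x [^]\<^bsub>Q\<^esub> n = \<one>\<^bsub>Q\<^esub> \<longleftrightarrow> d dvd n" for n :: nat
      proof -
        have "f x [^]\<^bsub>Q\<^esub> n = \<one>\<^bsub>Q\<^esub> \<longleftrightarrow> x [^] n \<in> kernel G Q f"
          using x by (simp add: kernel_def f.hom_nat_pow)
        also have "\<dots> \<longleftrightarrow> (x [^] n) [^] card ?C = \<one>"
          unfolding Q(3) using cyclic_subgroup_unique(3)[OF fin x C] pow_mem_generate[OF x] by blast
        also have "\<dots> \<longleftrightarrow> d dvd n" using x d cp by (simp add: nat_pow_pow pow_eq_id mult.commute)
        finally show ?thesis .
      qed
      thus ?thesis using f.H.ord_unique[of "f x" d] x by simp
    qed
    thus "supersolvable Q"
      using f.H.supersolvable_order_prime_mult[OF _ m ordQ dm, of "f x"] x Q(2) fin by (metis f.hom_closed finite_imageI)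
  qed
qed

section \<open>Cyclic subgroups of index four\<close>

text \<open>A cyclic group has at most one involution, and none if its order is odd. This will bound
  the fibres of squaring on cosets of K.\<close>

lemma (in group) card_square_roots_of_one:
  assumes fin: "finite (carrier G)" and x: "x \<in> carrier G"
  shows "card {v \<in> generate G {x}. v [^] (2::nat) = \<one>} \<le> (if even (ord x) then 2 else 1)"
proof (cases "even (ord x)")
  case True
  define d where "d = ord x div 2"
  have N0: "ord x > 0" using ord_ge_1[OF fin x] by simp
  have d: "d dvd ord x" "ord x div d = 2" "d \<noteq> 0" using True N0 by (auto simp: d_def elim!: evenE)
  have xd: "x [^] d \<in> carrier G" using x by simp
  have "{v \<in> generate G {x}. v [^] (2::nat) = \<one>} \<subseteq> generate G {x [^] d}"
    using mem_generate_pow[OF fin x d(1)] d(2) by auto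
  moreover have "card (generate G {x [^] d}) = 2"
    using generate_pow_card[OF xd] ord_pow[OF x d(1,3)] d(2) by simp
  moreover have "finite (generate G {x [^] d})"
    using finite_subset[OF subgroup.subset[OF generate_singleton_subgroup[OF xd]] fin] .
  ultimately show ?thesis
    using True card_mono[of "generate G {x [^] d}" "{v \<in> generate G {x}. v [^] (2::nat) = \<one>}"] by simp
next
  case False
  have "v = \<one>" if v: "v \<in> generate G {x}" "v [^] (2::nat) = \<one>" for v
  proof -
    have vG: "v \<in> carrier G" using generate_singleton_carrier[OF x v(1)] .
    have "ord v dvd ord x"
      using subgroup_pow_card[OF generate_singleton_subgroup[OF x] v(1)] generate_pow_card[OF x]
        pow_eq_id[OF vG] by simp
    moreover have "ord v dvd 2" using v(2) pow_eq_id[OF vG] by simp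
    ultimately have "ord v dvd gcd (ord x) 2" by simp
    also have "gcd (ord x) 2 = 1" using False by (simp add: coprime_iff_gcd_eq_1[symmetric])
    finally show "v = \<one>" using ord_eq_1[OF vG] by simp
  qed
  hence "{v \<in> generate G {x}. v [^] (2::nat) = \<one>} \<subseteq> {\<one>}" by blast
  hence "card {v \<in> generate G {x}. v [^] (2::nat) = \<one>} \<le> card {\<one>}" by (intro card_mono) auto
  thus ?thesis using False by simp
qed

text \<open>Here K is generated by x^3 and G/K is the alternating group A4; U is the union of the
  conjugates of A without K, and R consists of the elements mapping to involutions of A4.\<close>

locale index_four_group = group G for G (structure) +
  fixes x
  assumes fin: "finite (carrier G)" and x: "x \<in> carrier G"
    and order_eq: "order G = 4 * ord x" and three_dvd: "3 dvd ord x"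
    and core_central: "\<And>h. h \<in> carrier G \<Longrightarrow> h \<otimes> x [^] (3::nat) = x [^] (3::nat) \<otimes> h"
    and conj_Int: "\<And>g. g \<in> carrier G \<Longrightarrow> g \<notin> generate G {x} \<Longrightarrow>
      generate G {x} \<inter> generate G {g \<otimes> x \<otimes> inv g} = generate G {x [^] (3::nat)}"
begin

abbreviation "A \<equiv> generate G {x}"
abbreviation "K \<equiv> generate G {x [^] (3::nat)}"
definition "k = ord x div 3"

lemma ord_x: "ord x = 3 * k"
  using three_dvd by (simp add: k_def)

lemma k_pos: "k > 0"
  using ord_ge_1[OF fin x] ord_x by (simp add: Suc_le_eq)

lemma x3: "x [^] (3::nat) \<in> carrier G" using x by simp

lemma ord_x3: "ord (x [^] (3::nat)) = k"
  using ord_pow[OF x three_dvd] by (simp add: k_def)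

lemma A: "subgroup A G" and K: "subgroup K G"
  using generate_singleton_subgroup x x3 by auto

lemma AG: "a \<in> A \<Longrightarrow> a \<in> carrier G" and KG: "z \<in> K \<Longrightarrow> z \<in> carrier G"
  using subgroup.mem_carrier A K by metis+

lemma KA: "K \<subseteq> A"
  using generate_singleton_subset[OF A pow_mem_generate[OF x]] .

lemma finA: "finite A" and finK: "finite K"
  using finite_subset[OF subgroup.subset[OF A] fin] finite_subset[OF subgroup.subset[OF K] fin] .

lemma card_A: "card A = 3 * k" and card_K: "card K = k"
  using generate_pow_card[OF x] generate_pow_card[OF x3] ord_x ord_x3 by simp_all

lemma K_central:
  assumes "z \<in> K" "h \<in> carrier G"
  shows "h \<otimes> z = z \<otimes> h"
proof -
  have "x [^] (3::nat) \<in> {h \<in> carrier G. \<forall>c\<in>carrier G. h \<otimes> c = c \<otimes> h}"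
    using core_central x3 by auto
  hence "K \<subseteq> {h \<in> carrier G. \<forall>c\<in>carrier G. h \<otimes> c = c \<otimes> h}"
    using generate_singleton_subset[OF centralizer_subgroup] by blast
  thus ?thesis using assms by auto
qed

lemma K_normal: "K \<lhd> G"
  using central_subgroup_normal[OF K] K_central by blast

lemma conj_K: "z \<in> K \<Longrightarrow> t \<in> carrier G \<Longrightarrow> t \<otimes> z \<otimes> inv t = z"
  using K_central[of z t] KG by (simp add: m_assoc)

lemma x_notin_K: "x \<notin> K"
proof
  assume "x \<in> K"
  hence "card A \<le> card K" using generate_singleton_subset[OF K] finK by (intro card_mono) auto
  thus False using card_A card_K k_pos by simp
qed

text \<open>The conjugate lies in A \<inter> A^g = K, which is central, so conjugation did not move
  a. Read backwards: only elements of A conjugate an element of A - K into A.\<close>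

lemma conj_mem_A:
  assumes "g \<in> carrier G" "g \<notin> A" "a \<in> A" "g \<otimes> a \<otimes> inv g \<in> A"
  shows "a \<in> K"
proof -
  have aG: "a \<in> carrier G" using AG assms by blast
  have "g \<otimes> a \<otimes> inv g \<in> generate G {g \<otimes> x \<otimes> inv g}"
    using generate_conj[OF fin x assms(1)] assms(3) by blast
  hence c: "g \<otimes> a \<otimes> inv g \<in> K" using conj_Int[OF assms(1,2)] assms(4) by blast
  have "inv g \<otimes> (g \<otimes> a \<otimes> inv g) \<otimes> inv (inv g) = g \<otimes> a \<otimes> inv g"
    by (rule conj_K[OF c inv_closed[OF assms(1)]])
  hence "a = g \<otimes> a \<otimes> inv g" using conj_cancel(1)[OF assms(1) aG] assms(1) by simp
  thus ?thesis using c by simp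
qed

definition "U = (\<lambda>(t, a). t \<otimes> a \<otimes> inv t) ` (carrier G \<times> (A - K))"
definition "R = carrier G - K - U"

lemma U_I: "t \<in> carrier G \<Longrightarrow> a \<in> A \<Longrightarrow> a \<notin> K \<Longrightarrow> t \<otimes> a \<otimes> inv t \<in> U"
  by (auto simp: U_def)

lemma U_E:
  assumes "u \<in> U"
  obtains t a where "t \<in> carrier G" "a \<in> A" "a \<notin> K" "u = t \<otimes> a \<otimes> inv t"
  using assms by (auto simp: U_def)

lemma U_G: "U \<subseteq> carrier G" using AG by (auto simp: U_def)

lemma U_K: "U \<inter> K = {}"
proof -
  have False if u: "u \<in> U" "u \<in> K" for u
  proof -
    obtain t a where ta: "t \<in> carrier G" "a \<in> A" "a \<notin> K" "u = t \<otimes> a \<otimes> inv t" using U_E[OF u(1)] by blast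
    have "a = inv t \<otimes> u \<otimes> t" using ta AG conj_cancel(1) by simp
    also have "\<dots> = u" using conj_K[OF u(2), of "inv t"] ta(1) by simp
    finally show False using ta u by simp
  qed
  thus ?thesis by blast
qed

text \<open>Every element of U is t a t^-1 for exactly |A| pairs (t, a).\<close>

lemma sum_U:
  fixes w :: "'a \<Rightarrow> nat"
  assumes w: "\<And>t a. t \<in> carrier G \<Longrightarrow> a \<in> A \<Longrightarrow> w (t \<otimes> a \<otimes> inv t) = w a"
  shows "(\<Sum>u\<in>U. w u) = 4 * (\<Sum>a\<in>A - K. w a)"
proof -
  let ?f = "\<lambda>(t, a). t \<otimes> a \<otimes> inv t" and ?P = "carrier G \<times> (A - K)"
  have finP: "finite ?P" using fin finA by simp
  have fibre: "card {s \<in> ?P. ?f s = u} = 3 * k" if u: "u \<in> U" for u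
  proof -
    obtain t a where ta: "t \<in> carrier G" "a \<in> A" "a \<notin> K" "u = t \<otimes> a \<otimes> inv t" using U_E u by blast
    have aG: "a \<in> carrier G" using ta AG by blast
    \<comment> \<open>A second pair (t', b) gives s = inv t t', which conjugates b to a. By
      \<open>conj_mem_A\<close> it lies in A, and as A is abelian, b = a.\<close>
    have "{s \<in> ?P. ?f s = u} = (\<lambda>s. (t \<otimes> s, a)) ` A"
    proof (intro equalityI subsetI)
      fix p assume p: "p \<in> {s \<in> ?P. ?f s = u}"
      then obtain t' b where tb: "p = (t', b)" "t' \<in> carrier G" "b \<in> A" "b \<notin> K" "t' \<otimes> b \<otimes> inv t' = u" by auto
      have bG: "b \<in> carrier G" using tb AG by blast
      let ?s = "inv t \<otimes> t'"
      have sG: "?s \<in> carrier G" using ta tb by simp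
      have "?s \<otimes> b \<otimes> inv ?s = inv t \<otimes> (t' \<otimes> b \<otimes> inv t') \<otimes> t"
        using ta(1) tb(2) bG by (simp add: inv_mult_group m_assoc)
      also have "\<dots> = a" using tb(5) ta conj_cancel(1)[OF ta(1) aG] by simp
      finally have sb: "?s \<otimes> b \<otimes> inv ?s = a" .
      have sA: "?s \<in> A" using conj_mem_A[OF sG _ tb(3)] sb ta(2) tb(4) by auto
      have "?s \<otimes> b \<otimes> inv ?s = b"
        using generate_singleton_commute[OF fin x sA tb(3)] sG bG by (simp add: m_assoc)
      hence "b = a" using sb by simp
      moreover have "t' = t \<otimes> ?s" using ta(1) tb(2) by (simp add: m_assoc[symmetric])
      ultimately show "p \<in> (\<lambda>s. (t \<otimes> s, a)) ` A" using tb(1) sA by auto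
    next
      fix p assume "p \<in> (\<lambda>s. (t \<otimes> s, a)) ` A"
      then obtain s where s: "s \<in> A" "p = (t \<otimes> s, a)" by blast
      have sG: "s \<in> carrier G" using s AG by blast
      have "t \<otimes> s \<otimes> a \<otimes> inv (t \<otimes> s) = t \<otimes> (s \<otimes> a \<otimes> inv s) \<otimes> inv t"
        using ta(1) sG aG by (simp add: inv_mult_group m_assoc)
      also have "s \<otimes> a \<otimes> inv s = a"
        using generate_singleton_commute[OF fin x s(1) ta(2)] sG aG by (simp add: m_assoc)
      finally show "p \<in> {s \<in> ?P. ?f s = u}" using s ta sG by simp
    qed
    moreover have "inj_on (\<lambda>s. (t \<otimes> s, a)) A"
      using ta(1) AG by (intro inj_onI) simp
    ultimately show ?thesis using card_A by (simp add: card_image)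
  qed
  \<comment> \<open>Double counting over pairs: the factor |G| on one side and 3k = |A| on the other
    leave the index 4.\<close>
  have "order G * (\<Sum>a\<in>A - K. w a) = (\<Sum>t\<in>carrier G. \<Sum>a\<in>A - K. w a)"
    by (simp add: order_def)
  also have "\<dots> = (\<Sum>s\<in>?P. w (snd s))" by (simp only: sum.cartesian_product) (simp add: case_prod_beta)
  also have "\<dots> = (\<Sum>s\<in>?P. w (?f s))" using w by (intro sum.cong) auto
  also have "\<dots> = (\<Sum>u\<in>?f ` ?P. \<Sum>s | s \<in> ?P \<and> ?f s = u. w (?f s))"
    by (rule sum.image_gen[OF finP])
  also have "\<dots> = (\<Sum>u\<in>U. \<Sum>s | s \<in> ?P \<and> ?f s = u. w u)"
    unfolding U_def by (intro sum.cong) auto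
  also have "\<dots> = (\<Sum>u\<in>U. 3 * k * w u)" using fibre by simp
  also have "\<dots> = 3 * k * (\<Sum>u\<in>U. w u)" by (rule sum_distrib_left[symmetric])
  finally show ?thesis using k_pos by (simp add: order_eq ord_x)
qed

text \<open>Counting modulo K as in A4: of twelve elements, the identity and eight elements of order
  3 are removed and three remain.\<close>

lemma card_R: "card R = 3 * k"
proof -
  have finU: "finite U" using finite_subset[OF U_G fin] .
  have "card (A - K) = 2 * k" using card_Diff_subset[OF finK KA] card_A card_K by simp
  hence U: "card U = 8 * k" using sum_U[of "\<lambda>_. 1"] by simp
  have "card (carrier G - K) = 11 * k"
    using card_Diff_subset[OF finK subgroup.subset[OF K]] order_eq ord_x card_K by (simp add: order_def)
  moreover have "U \<subseteq> carrier G - K" using U_G U_K by blast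
  ultimately show ?thesis unfolding R_def using card_Diff_subset[OF finU] U by simp
qed

lemma R_G: "r \<in> R \<Longrightarrow> r \<in> carrier G" and R_K: "r \<in> R \<Longrightarrow> r \<notin> K" by (auto simp: R_def)

lemma R_A: "r \<in> R \<Longrightarrow> r \<notin> A"
  using U_I[of \<one> r] AG by (auto simp: R_def)

text \<open>Since K is central and A - K is a union of cosets of K, so is U, and with it R.\<close>

lemma R_mult_K:
  assumes "r \<in> R" "z \<in> K"
  shows "r \<otimes> z \<in> R"
proof -
  have G: "r \<in> carrier G" "z \<in> carrier G" using assms R_G KG by auto
  have iz: "inv z \<in> K" using subgroup.m_inv_closed[OF K assms(2)] .
  have r: "r = r \<otimes> z \<otimes> inv z" using G by (simp add: m_assoc)
  have "r \<otimes> z \<notin> K" using R_K[OF assms(1)] r subgroup.m_closed[OF K _ iz] by metis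
  moreover have "r \<otimes> z \<notin> U"
  proof
    assume "r \<otimes> z \<in> U"
    then obtain t a where ta: "t \<in> carrier G" "a \<in> A" "a \<notin> K" "r \<otimes> z = t \<otimes> a \<otimes> inv t" using U_E by blast
    have aG: "a \<in> carrier G" using ta AG by blast
    have "t \<otimes> (a \<otimes> inv z) \<otimes> inv t = t \<otimes> a \<otimes> (inv z \<otimes> inv t)" using ta(1) aG G by (simp add: m_assoc)
    also have "\<dots> = t \<otimes> a \<otimes> (inv t \<otimes> inv z)" using K_central[OF iz, of "inv t"] ta(1) by simp
    also have "\<dots> = r" using r ta aG G by (simp add: m_assoc)
    finally have "r = t \<otimes> (a \<otimes> inv z) \<otimes> inv t" ..
    moreover have "a \<otimes> inv z \<in> A" using subgroup.m_closed[OF A ta(2)] iz KA by blast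
    moreover have "a \<otimes> inv z \<notin> K"
    proof
      assume "a \<otimes> inv z \<in> K"
      hence "a \<otimes> inv z \<otimes> z \<in> K" using subgroup.m_closed[OF K _ assms(2)] by blast
      thus False using ta(3) aG G by (simp add: m_assoc)
    qed
    ultimately have "r \<in> U" using U_I ta(1) by metis
    thus False using assms(1) by (simp add: R_def)
  qed
  ultimately show ?thesis using G by (simp add: R_def)
qed

lemma R_conj:
  assumes "r \<in> R" "t \<in> carrier G"
  shows "t \<otimes> r \<otimes> inv t \<in> R"
proof -
  have rG: "r \<in> carrier G" using assms R_G by blast
  let ?c = "t \<otimes> r \<otimes> inv t"
  have cG: "?c \<in> carrier G" using rG assms by simp
  have undo: "inv t \<otimes> ?c \<otimes> inv (inv t) = r" using conj_cancel(1) rG assms by simp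
  have "?c \<notin> K"
  proof
    assume "?c \<in> K"
    hence "inv t \<otimes> ?c \<otimes> inv (inv t) \<in> K" using conj_K[of ?c "inv t"] assms by simp
    thus False using undo R_K[OF assms(1)] by simp
  qed
  moreover have "?c \<notin> U"
  proof
    assume "?c \<in> U"
    then obtain s a where sa: "s \<in> carrier G" "a \<in> A" "a \<notin> K" "?c = s \<otimes> a \<otimes> inv s" using U_E by blast
    have "r = inv t \<otimes> (s \<otimes> a \<otimes> inv s) \<otimes> inv (inv t)" using undo sa(4) by simp
    also have "\<dots> = (inv t \<otimes> s) \<otimes> a \<otimes> inv (inv t \<otimes> s)"
      using sa AG[OF sa(2)] assms(2) by (simp add: inv_mult_group m_assoc)
    also have "\<dots> \<in> U" using sa assms(2) by (intro U_I) auto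
    finally show False using assms(1) by (simp add: R_def)
  qed
  ultimately show ?thesis using cG by (simp add: R_def)
qed

text \<open>If r^2 were conjugate to some a in A - K, a conjugate s of r would satisfy s^2 = a and
  so commute with a. Then s would lie in A, but R does not meet A.\<close>

lemma R_square: 
  assumes r: "r \<in> R"
  shows "r \<otimes> r \<in> R \<union> K"
proof (rule ccontr)
  assume "r \<otimes> r \<notin> R \<union> K"
  hence "r \<otimes> r \<in> U" using R_G[OF r] by (auto simp: R_def)
  then obtain t a where ta: "t \<in> carrier G" "a \<in> A" "a \<notin> K" "r \<otimes> r = t \<otimes> a \<otimes> inv t" using U_E by blast
  have rG: "r \<in> carrier G" using r R_G by blast
  have aG: "a \<in> carrier G" using ta AG by blast
  let ?s = "inv t \<otimes> r \<otimes> t"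
  have sR: "?s \<in> R" using R_conj[OF r, of "inv t"] ta(1) by simp
  have sG: "?s \<in> carrier G" using sR R_G by blast
  have "?s \<otimes> ?s = inv t \<otimes> (r \<otimes> r) \<otimes> t"
  proof -
    have "?s \<otimes> ?s = inv t \<otimes> r \<otimes> (t \<otimes> inv t) \<otimes> r \<otimes> t"
      using ta(1) rG by (simp only: m_assoc m_closed inv_closed)
    thus ?thesis using ta(1) rG by (simp add: m_assoc)
  qed
  hence ss: "?s \<otimes> ?s = a" using ta(4) conj_cancel(1)[OF ta(1) aG] by simp
  have "?s \<otimes> a \<otimes> inv ?s = a"
    unfolding ss[symmetric] using sG by (simp add: m_assoc)
  thus False using conj_mem_A[OF sG R_A[OF sR] ta(2)] ta(2,3) by simp
qed

text \<open>If x fixed the coset r K, then inv r, which is outside A, would conjugate x to z x in A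
  and so force x into K. In A4 terms, an element of order 3 centralises no involution.\<close>

lemma conj_x_notin_coset:
  assumes r: "r \<in> R" and z: "z \<in> K"
  shows "x \<otimes> r \<otimes> inv x \<noteq> r \<otimes> z"
proof
  assume eq: "x \<otimes> r \<otimes> inv x = r \<otimes> z"
  have G: "r \<in> carrier G" "z \<in> carrier G" using r z R_G KG by auto
  have "x \<otimes> r = r \<otimes> z \<otimes> x" using eq G x by (metis inv_solve_right m_closed)
  hence "inv r \<otimes> x \<otimes> r = z \<otimes> x" using G x by (simp add: m_assoc) (simp add: m_assoc[symmetric])
  moreover have "z \<otimes> x \<in> A" using subgroup.m_closed[OF A] KA z generate.incl[of x "{x}" G] by blast
  ultimately have "inv r \<otimes> x \<otimes> inv (inv r) \<in> A" using G by simp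
  moreover have "inv r \<notin> A" using R_A[OF r] G subgroup.m_inv_closed[OF A, of "inv r"] by auto
  ultimately have "x \<in> K" using conj_mem_A[of "inv r" x] G generate.incl[of x "{x}" G] by simp
  thus False using x_notin_K by simp
qed

lemma R_nonempty: "R \<noteq> {}"
  using card_R k_pos by auto

text \<open>Conjugation by x permutes the three cosets of K in R cyclically; since x^3 is central, i
  matters only modulo 3.\<close>

definition "cyc i r = x [^] (i::nat) \<otimes> r \<otimes> inv (x [^] i)"

lemma cyc_R: "r \<in> R \<Longrightarrow> cyc i r \<in> R"
  unfolding cyc_def using R_conj x by simp

lemma cyc_Suc: "r \<in> carrier G \<Longrightarrow> cyc (Suc i) r = x \<otimes> cyc i r \<otimes> inv x"
  unfolding cyc_def nat_pow_Suc2[OF x] using x by (simp add: inv_mult_group m_assoc)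

lemma cyc_3: "r \<in> carrier G \<Longrightarrow> cyc 3 r = r"
  unfolding cyc_def core_central[symmetric] using x3 by (simp add: m_assoc)

lemma R_cosets:
  assumes r: "r \<in> R"
  shows "R = (\<Union>i\<in>{0,1,2}. (\<lambda>z. cyc i r \<otimes> z) ` K)" "disjoint_family_on (\<lambda>i. (\<lambda>z. cyc i r \<otimes> z) ` K) {0,1,2}"
proof -
  let ?S = "\<lambda>i. (\<lambda>z. cyc i r \<otimes> z) ` K"
  have rG: "r \<in> carrier G" using r R_G by blast
  have cG: "cyc i r \<in> carrier G" for i using cyc_R[OF r] R_G by blast
  have sub: "?S i \<subseteq> R" for i using R_mult_K cyc_R[OF r] by blast
  have card: "card (?S i) = k" for i
  proof -
    have "inj_on (\<lambda>z. cyc i r \<otimes> z) K" using cG KG by (intro inj_onI) simp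
    thus ?thesis using card_K by (simp add: card_image)
  qed
  have disj: "?S i \<inter> ?S j = {}" if ne: "\<And>z. z \<in> K \<Longrightarrow> cyc j r \<noteq> cyc i r \<otimes> z" for i j
  proof -
    have False if "y \<in> K" "z \<in> K" "cyc i r \<otimes> y = cyc j r \<otimes> z" for y z
    proof -
      have "cyc j r = cyc j r \<otimes> z \<otimes> inv z" using cG KG that by (simp add: m_assoc)
      also have "\<dots> = cyc i r \<otimes> y \<otimes> inv z" using that(3) by simp
      also have "\<dots> = cyc i r \<otimes> (y \<otimes> inv z)"
        using cG[of i] KG[OF that(1)] KG[OF that(2)] by (simp add: m_assoc)
      finally show False using ne[of "y \<otimes> inv z"] that K by (simp add: subgroup.m_closed subgroup.m_inv_closed)
    qed
    thus ?thesis by blast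
  qed
  have step: "cyc (Suc i) r \<noteq> cyc i r \<otimes> z" if "z \<in> K" for i z
    using conj_x_notin_coset[OF cyc_R[OF r] that] cyc_Suc[OF rG] by simp
  have c0: "cyc 0 r = r" using rG by (simp add: cyc_def)
  \<comment> \<open>Neighbouring cosets are already known to differ. The cosets 2 and 0 are
    neighbours too, because one more conjugation by x closes the cycle.\<close>
  have "cyc 2 r \<noteq> cyc 0 r \<otimes> z" if z: "z \<in> K" for z
  proof
    assume eq: "cyc 2 r = cyc 0 r \<otimes> z"
    have zG: "z \<in> carrier G" using z KG by blast
    have "r = cyc (Suc 2) r" using cyc_3[OF rG] by (simp add: numeral_3_eq_3)
    also have "\<dots> = x \<otimes> (r \<otimes> z) \<otimes> inv x" using cyc_Suc[OF rG, of 2] eq c0 by simp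
    also have "\<dots> = x \<otimes> r \<otimes> (z \<otimes> inv x)" using x rG zG by (simp add: m_assoc)
    also have "\<dots> = x \<otimes> r \<otimes> (inv x \<otimes> z)" using K_central[OF z, of "inv x"] x by simp
    also have "\<dots> = x \<otimes> r \<otimes> inv x \<otimes> z" using x rG zG by (simp add: m_assoc)
    finally have "x \<otimes> r \<otimes> inv x = r \<otimes> inv z" using x rG zG by (metis inv_closed inv_solve_right m_closed)
    thus False using conj_x_notin_coset[OF r] subgroup.m_inv_closed[OF K z] by blast
  qed
  hence d02: "?S 0 \<inter> ?S 2 = {}" using disj by blast
  have d01: "?S 0 \<inter> ?S 1 = {}" using disj[of 1 0] step[of _ 0] by (auto simp: One_nat_def)
  have d12: "?S 1 \<inter> ?S 2 = {}" using disj[of 2 1] step[of _ 1] by (simp add: numeral_2_eq_2)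
  show dj: "disjoint_family_on ?S {0,1,2}"
    unfolding disjoint_family_on_def using d01 d02 d12 by (simp add: Int_commute)
  have "card (\<Union>i\<in>{0,1,2}. ?S i) = (\<Sum>i\<in>{0,1,2::nat}. card (?S i))"
    using dj finK by (intro card_UN_disjoint) (auto simp: disjoint_family_on_def)
  hence "card (\<Union>i\<in>{0,1,2}. ?S i) = card R" using card card_R by simp
  moreover have "finite R" using fin by (simp add: R_def)
  ultimately show "R = (\<Union>i\<in>{0,1,2}. ?S i)"
    using sub by (metis (no_types, lifting) UN_least card_subset_eq)
qed

end

lemma (in group) subgroup_nat_pow_closed:
  assumes "subgroup H G" "h \<in> H"
  shows "h [^] (n::nat) \<in> H"
  by (induction n) (use assms in \<open>auto simp: subgroup.one_closed subgroup.m_closed\<close>)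

context index_four_group begin

text \<open>Otherwise r^2 lies in the coset of a conjugate of r by some y = x^i, so conjugation by y
  squares r modulo K. This leads to r^7 in K, impossible for r outside K because G/K has order
  12.\<close>

lemma R_square_mem_K:
  assumes r: "r \<in> R"
  shows "r \<otimes> r \<in> K"
proof (rule ccontr)
  assume notK: "r \<otimes> r \<notin> K"
  have rG: "r \<in> carrier G" using r R_G by blast
  have "r \<otimes> r \<in> R" using R_square[OF r] notK by blast
  then obtain i z where i: "i \<in> {0,1,2}" and z: "z \<in> K" and eq: "r \<otimes> r = cyc i r \<otimes> z"
    using R_cosets(1)[OF r] by blast
  define y where "y = x [^] i"
  define w where "w = inv z"
  have zG: "z \<in> carrier G" using z KG by blast
  have w: "w \<in> K" "w \<in> carrier G" using subgroup.m_inv_closed[OF K z] KG by (auto simp: w_def)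
  have y: "y \<in> carrier G" using x by (simp add: y_def)
  have "i \<noteq> 0"
  proof
    assume "i = 0"
    hence "r \<otimes> r = r \<otimes> z" using eq rG by (simp add: cyc_def)
    hence "r = z" using rG zG by simp
    thus False using R_K[OF r] z by simp
  qed
  have conj_r: "y \<otimes> r \<otimes> inv y = r [^] (2::nat) \<otimes> w"
  proof -
    have "cyc i r = r \<otimes> r \<otimes> inv z"
      using eq rG zG cyc_R[OF r, of i, THEN R_G] by (metis inv_solve_right m_closed)
    thus ?thesis using rG by (simp add: cyc_def y_def w_def numeral_2_eq_2)
  qed
  have rw: "r [^] (n::nat) \<otimes> w = w \<otimes> r [^] n" for n using K_central[OF w(1)] rG by simp
  \<comment> \<open>The central error w accumulates, so both exponents are tracked: (n, m) becomes
    (2n, n + m), and three rounds lead from (1, 0) through (2, 1) and (4, 3) to (8, 7).\<close>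
  have conj_rw: "y \<otimes> (r [^] (n::nat) \<otimes> w [^] (m::nat)) \<otimes> inv y = r [^] (2 * n) \<otimes> w [^] (n + m)" for n m
  proof -
    have wm: "w [^] m \<in> K" using w(1) K by (simp add: subgroup_nat_pow_closed)
    have "y \<otimes> (r [^] n \<otimes> w [^] m) \<otimes> inv y = y \<otimes> r [^] n \<otimes> (w [^] m \<otimes> inv y)"
      using y rG w by (simp add: m_assoc)
    also have "w [^] m \<otimes> inv y = inv y \<otimes> w [^] m" using K_central[OF wm] y by simp
    also have "y \<otimes> r [^] n \<otimes> (inv y \<otimes> w [^] m) = (y \<otimes> r [^] n \<otimes> inv y) \<otimes> w [^] m"
      using y rG w by (simp add: m_assoc)
    also have "y \<otimes> r [^] n \<otimes> inv y = (r [^] (2::nat) \<otimes> w) [^] n"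
      using conj_pow[OF y rG, of n] conj_r by simp
    also have "\<dots> = r [^] (2 * n) \<otimes> w [^] n"
      using pow_mult_distrib[OF rw[of 2], of n] rG w(2) by (simp add: nat_pow_pow)
    finally show ?thesis using rG w by (simp add: m_assoc nat_pow_mult)
  qed
  \<comment> \<open>Conjugation by y squares r modulo K and its cube is trivial, so r^8 = r modulo K.\<close>
  have "r = r [^] (8::nat) \<otimes> w [^] (7::nat)"
  proof -
    have "y \<otimes> (y \<otimes> (y \<otimes> r \<otimes> inv y) \<otimes> inv y) \<otimes> inv y = r [^] (8::nat) \<otimes> w [^] (7::nat)"
      using conj_rw[of 1 0] conj_rw[of 2 1] conj_rw[of 4 3] rG w(2) by simp
    moreover have "y \<otimes> (y \<otimes> (y \<otimes> r \<otimes> inv y) \<otimes> inv y) \<otimes> inv y = y [^] (3::nat) \<otimes> r \<otimes> inv (y [^] (3::nat))"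
      using y rG by (simp add: numeral_3_eq_3 m_assoc inv_mult_group)
    moreover have "y [^] (3::nat) \<in> K"
      using x pow_mem_generate[OF x3, of i] by (simp add: y_def nat_pow_pow mult.commute)
    hence "y [^] (3::nat) \<otimes> r \<otimes> inv (y [^] (3::nat)) = r"
      using K_central[of "y [^] (3::nat)" r, symmetric] y rG by (simp add: m_assoc)
    ultimately show ?thesis by simp
  qed
  hence "r \<otimes> \<one> = r \<otimes> (r [^] (7::nat) \<otimes> w [^] (7::nat))"
    using rG w(2) nat_pow_mult[OF rG, of 1 7] by (simp add: m_assoc[symmetric])
  hence "r [^] (7::nat) \<otimes> w [^] (7::nat) = \<one>" using rG w(2) by (simp del: r_one)
  hence "r [^] (7::nat) = inv (w [^] (7::nat))" using rG w(2) by (metis inv_equality nat_pow_closed)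
  hence r7: "r [^] (7::nat) \<in> K"
    using w(1) K by (simp add: subgroup_nat_pow_closed subgroup.m_inv_closed)
  obtain Q :: "'a monoid" and f where f: "group_hom G Q f" "f ` carrier G = carrier Q"
    "kernel G Q f = K" "order Q * card K = order G"
    using normal.quotient_exists[OF K_normal] by blast
  interpret f: group_hom G Q f by fact
  have fr: "f r \<in> carrier Q" using rG by simp
  have "order Q = 12" using f(4) card_K order_eq ord_x k_pos by simp
  hence "f.H.ord (f r) dvd 12" using f.H.ord_dvd_group_order[OF fr] by simp
  moreover have "f r [^]\<^bsub>Q\<^esub> (7::nat) = \<one>\<^bsub>Q\<^esub>"
    using r7 unfolding f(3)[symmetric] kernel_def using rG by (simp add: f.hom_nat_pow)
  hence "f.H.ord (f r) dvd 7" using f.H.pow_eq_id[OF fr] by simp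
  ultimately have "f.H.ord (f r) dvd gcd 12 7" by simp
  also have "gcd 12 7 = (1::nat)" by (simp add: gcd_non_0_nat)
  finally have "f r = \<one>\<^bsub>Q\<^esub>" using f.H.ord_eq_1[OF fr] by simp
  hence "r \<in> kernel G Q f" using rG by (simp add: kernel_def)
  thus False using f(3) R_K[OF r] by simp
qed

text \<open>The bound on the number of square roots of 1 in K, hence on how many elements of a coset
  of K in R share a square.\<close>

definition "c = (if even k then 2 else 1 :: nat)"

text \<open>Squaring maps the coset r K into K, at most c to one because (r z)^2 = r^2 z^2, and an
  element has at most twice the order of its square.\<close>

lemma sum_ord_coset:
  assumes r: "r \<in> R"
  shows "(\<Sum>z\<in>K. ord (r \<otimes> z)) \<le> 2 * c * cyclic_order_sum k"
proof -
  define s where "s z = (r \<otimes> z) \<otimes> (r \<otimes> z)" for z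
  have rG: "r \<in> carrier G" using r R_G by blast
  have sK: "s z \<in> K" if "z \<in> K" for z
    using R_square_mem_K[OF R_mult_K[OF r that]] by (simp add: s_def)
  have s_eq: "s z = r \<otimes> r \<otimes> (z \<otimes> z)" if z: "z \<in> K" for z
  proof -
    have zG: "z \<in> carrier G" using z KG by blast
    have "s z = r \<otimes> (z \<otimes> r) \<otimes> z" using rG zG by (simp add: s_def m_assoc)
    also have "\<dots> = r \<otimes> (r \<otimes> z) \<otimes> z" using K_central[OF z rG] by simp
    finally show ?thesis using rG zG by (simp add: m_assoc)
  qed
  have fibre: "card {z \<in> K. s z = y} \<le> c" if y: "y \<in> s ` K" for y
  proof -
    obtain z0 where z0: "z0 \<in> K" "y = s z0" using y by blast
    have z0G: "z0 \<in> carrier G" using z0 KG by blast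
    have "(\<lambda>z. inv z0 \<otimes> z) ` {z \<in> K. s z = y} \<subseteq> {v \<in> K. v [^] (2::nat) = \<one>}"
    proof clarify
      fix z assume z: "z \<in> K" "y = s z"
      have zG: "z \<in> carrier G" using z KG by blast
      have "z \<otimes> z = z0 \<otimes> z0" using z z0 s_eq rG zG z0G by simp
      have "inv z0 \<otimes> z \<otimes> (inv z0 \<otimes> z) = inv z0 \<otimes> (z \<otimes> inv z0) \<otimes> z"
        using zG z0G by (simp add: m_assoc)
      also have "\<dots> = inv z0 \<otimes> (inv z0 \<otimes> z) \<otimes> z"
        using K_central[OF z(1), of "inv z0"] z0G by simp
      also have "\<dots> = inv z0 \<otimes> (inv z0 \<otimes> (z0 \<otimes> z0))"
        using \<open>z \<otimes> z = z0 \<otimes> z0\<close> zG z0G by (simp add: m_assoc)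
      also have "\<dots> = \<one>" using z0G by (simp add: m_assoc[symmetric])
      finally have "(inv z0 \<otimes> z) [^] (2::nat) = \<one>" using zG z0G by (simp add: numeral_2_eq_2)
      moreover have "inv z0 \<otimes> z \<in> K" using z z0 K by (simp add: subgroup.m_closed subgroup.m_inv_closed)
      ultimately show "inv z0 \<otimes> z \<in> K \<and> (inv z0 \<otimes> z) [^] (2::nat) = \<one>" by blast
    qed
    moreover have "inj_on (\<lambda>z. inv z0 \<otimes> z) {z \<in> K. s z = y}"
      using z0G KG by (intro inj_onI) simp
    ultimately have "card {z \<in> K. s z = y} \<le> card {v \<in> K. v [^] (2::nat) = \<one>}"
      using finK by (intro card_inj_on_le) auto
    also have "\<dots> \<le> c" using card_square_roots_of_one[OF fin x3] ord_x3 by (simp add: c_def)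
    finally show ?thesis .
  qed
  have "ord (r \<otimes> z) \<le> 2 * ord (s z)" if z: "z \<in> K" for z
  proof -
    have G: "r \<otimes> z \<in> carrier G" using rG KG z by simp
    hence sG: "s z \<in> carrier G" by (simp add: s_def)
    have "s z = (r \<otimes> z) [^] (2::nat)" using G by (simp add: s_def numeral_2_eq_2)
    hence "(r \<otimes> z) [^] (2 * ord (s z)) = \<one>" using G sG by (simp add: nat_pow_pow[symmetric])
    hence "ord (r \<otimes> z) dvd 2 * ord (s z)" using pow_eq_id[OF G] by simp
    thus ?thesis using ord_ge_1[OF fin sG] by (intro dvd_imp_le) auto
  qed
  hence "(\<Sum>z\<in>K. ord (r \<otimes> z)) \<le> (\<Sum>z\<in>K. 2 * ord (s z))" by (rule sum_mono)
  also have "\<dots> = (\<Sum>y\<in>s ` K. \<Sum>z | z \<in> K \<and> s z = y. 2 * ord (s z))"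
    by (rule sum.image_gen[OF finK])
  also have "\<dots> = (\<Sum>y\<in>s ` K. card {z \<in> K. s z = y} * (2 * ord y))" by (intro sum.cong) auto
  also have "\<dots> \<le> (\<Sum>y\<in>s ` K. c * (2 * ord y))" using fibre by (intro sum_mono mult_le_mono1) auto
  also have "\<dots> \<le> (\<Sum>y\<in>K. c * (2 * ord y))" using sK finK by (intro sum_mono2) auto
  also have "\<dots> = 2 * c * cyclic_order_sum k"
    using sum_ord_generate[OF fin x3] ord_x3 by (simp add: sum_distrib_left[symmetric])
  finally show ?thesis .
qed

text \<open>K contributes f(k), U four times f(3k) - f(k), and the three cosets in R at most 6 c
  f(k). For odd k this gives psi <= 31/7 f(3k) against 11 f(3k) for the cyclic group, a ratio of
  exactly 31/77 that A4 attains. For even k it gives 37/7 f(3k), and the factor 14 in place of 11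
  absorbs the difference.\<close>

lemma psi_le: "77 * psi G \<le> 31 * cyclic_order_sum (order G)"
proof -
  obtain r where r: "r \<in> R" using R_nonempty by blast
  let ?F = cyclic_order_sum
  let ?S = "\<lambda>i. (\<lambda>z. cyc i r \<otimes> z) ` K"
  have cG: "cyc i r \<in> carrier G" for i using cyc_R[OF r] R_G by blast
  have "(\<Sum>u\<in>R. ord u) = (\<Sum>u\<in>(\<Union>i\<in>{0,1,2}. ?S i). ord u)"
    using R_cosets(1)[OF r] by simp
  also have "\<dots> = (\<Sum>i\<in>{0,1,2::nat}. \<Sum>u\<in>?S i. ord u)"
    using R_cosets(2)[OF r] finK by (intro sum.UNION_disjoint) (auto simp: disjoint_family_on_def)
  also have "\<dots> = (\<Sum>i\<in>{0,1,2::nat}. \<Sum>z\<in>K. ord (cyc i r \<otimes> z))"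
  proof (rule sum.cong)
    fix i :: nat
    have "inj_on (\<lambda>z. cyc i r \<otimes> z) K" using cG KG by (intro inj_onI) simp
    thus "(\<Sum>u\<in>?S i. ord u) = (\<Sum>z\<in>K. ord (cyc i r \<otimes> z))" by (simp add: sum.reindex)
  qed simp
  also have "\<dots> \<le> (\<Sum>i\<in>{0,1,2::nat}. 2 * c * ?F k)"
    by (intro sum_mono sum_ord_coset cyc_R r)
  finally have R: "(\<Sum>u\<in>R. ord u) \<le> 6 * c * ?F k" by simp
  have U: "(\<Sum>u\<in>U. ord u) = 4 * (\<Sum>a\<in>A - K. ord a)" using sum_U ord_conj AG by blast
  have K': "(\<Sum>z\<in>K. ord z) = ?F k" using sum_ord_generate[OF fin x3] ord_x3 by simp
  have A': "(\<Sum>a\<in>A - K. ord a) + ?F k = ?F (3 * k)"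
    using sum.subset_diff[OF KA finA, of ord] sum_ord_generate[OF fin x] ord_x K' by simp
  have "psi G = (\<Sum>g\<in>carrier G - K. ord g) + (\<Sum>z\<in>K. ord z)"
    unfolding psi_def using sum.subset_diff[OF subgroup.subset[OF K] fin] .
  also have "(\<Sum>g\<in>carrier G - K. ord g) = (\<Sum>u\<in>R. ord u) + (\<Sum>u\<in>U. ord u)"
    unfolding R_def using U_G U_K fin by (intro sum.subset_diff) auto
  finally have psi: "psi G + 3 * ?F k \<le> 4 * ?F (3 * k) + 6 * c * ?F k"
    using R U K' A' by simp
  have F3: "7 * ?F k \<le> ?F (3 * k)" using cyclic_order_sum_3 k_pos by simp
  have F4: "(if even k then 14 else 11) * ?F (3 * k) \<le> ?F (order G)"
    using cyclic_order_sum_4[of "3 * k"] k_pos order_eq ord_x by simp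
  show ?thesis
  proof (cases "even k")
    case True thus ?thesis using psi F3 F4 by (simp add: c_def)
  next
    case False thus ?thesis using psi F3 F4 by (simp add: c_def)
  qed
qed

end

section \<open>Subgroups of index two and the index four alternative\<close>

lemma (in group) index_two_coset:
  assumes "finite (carrier G)" "subgroup A G" "subgroup M G" "A \<subseteq> M" "card M = 2 * card A"
    and u: "u \<in> M" "u \<notin> A" and v: "v \<in> M" "v \<notin> A"
  shows "v \<otimes> inv u \<in> A"
proof (rule ccontr)
  assume no: "v \<otimes> inv u \<notin> A"
  have G: "u \<in> carrier G" "v \<in> carrier G" using u v assms(3) subgroup.mem_carrier by metis+
  have AG: "A \<subseteq> carrier G" using subgroup.subset[OF assms(2)] .
  have finM: "finite M" using finite_subset[OF subgroup.subset[OF assms(3)] assms(1)] .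
  have finA: "finite A" using finite_subset[OF assms(4) finM] .
  have vn: "v \<notin> A #> u" using no subgroup.rcos_module[OF assms(2) is_group G] by simp
  have sub: "A #> u \<subseteq> M" using assms(3,4) u by (auto simp: r_coset_def intro: subgroup.m_closed)
  have "A \<inter> (A #> u) = {}"
  proof -
    have False if a: "a \<in> A" "a \<otimes> u \<in> A" for a
    proof -
      have "inv a \<otimes> (a \<otimes> u) \<in> A" using a assms(2) by (simp add: subgroup.m_closed subgroup.m_inv_closed)
      thus False using u(2) G a AG by (simp add: m_assoc[symmetric] subset_iff)
    qed
    thus ?thesis by (auto simp: r_coset_def)
  qed
  moreover have "card (A #> u) = card A"
    using card_rcosets_equal[OF rcosetsI[OF AG G(1)] AG] by simp
  moreover have "finite (A #> u)" using finite_subset[OF sub finM] .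
  ultimately have "card (A \<union> (A #> u)) = card M" using finA assms(5) by (simp add: card_Un_disjoint)
  hence "A \<union> (A #> u) = M" using sub assms(4) finM by (intro card_subset_eq) auto
  thus False using v vn by blast
qed

lemma (in group) index_two_square:
  assumes "finite (carrier G)" "subgroup A G" "subgroup M G" "A \<subseteq> M" "card M = 2 * card A" "v \<in> M"
  shows "v \<otimes> v \<in> A"
proof (rule ccontr)
  assume no: "v \<otimes> v \<notin> A"
  have v: "v \<notin> A" using no assms(2) by (auto intro: subgroup.m_closed)
  have vG: "v \<in> carrier G" using assms(3,6) subgroup.mem_carrier by metis
  have "v \<otimes> v \<otimes> inv v \<in> A"
    using index_two_coset[OF assms(1-5) assms(6) v _ no] assms(3,6) by (simp add: subgroup.m_closed)
  thus False using v vG by (simp add: m_assoc)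
qed

text \<open>If g h inv g were outside M, so would be g, and both would lie in the same coset of M.
  As g^2 is in M, this would put g h and therefore g into M.\<close>

lemma (in group) index_two_conj:
  assumes "finite (carrier G)" "subgroup M G" "order G = 2 * card M" "g \<in> carrier G" "h \<in> M"
  shows "g \<otimes> h \<otimes> inv g \<in> M"
proof (rule ccontr)
  assume no: "g \<otimes> h \<otimes> inv g \<notin> M"
  have hG: "h \<in> carrier G" using assms(2,5) subgroup.mem_carrier by metis
  have g: "g \<notin> M" using no assms by (auto simp: subgroup.m_closed subgroup.m_inv_closed)
  note cover = index_two_coset[OF assms(1,2) subgroup_self subgroup.subset[OF assms(2)] assms(3)[unfolded order_def]]
  have "g \<otimes> h \<otimes> inv g \<otimes> inv g \<in> M" using cover[of g "g \<otimes> h \<otimes> inv g"] g no assms(4) hG by simp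
  moreover have "g \<otimes> g \<in> M"
    using index_two_square[OF assms(1,2) subgroup_self subgroup.subset[OF assms(2)] assms(3)[unfolded order_def] assms(4)] .
  ultimately have "g \<otimes> h \<otimes> inv g \<otimes> inv g \<otimes> (g \<otimes> g) \<otimes> inv h \<in> M"
    using assms(2,5) by (simp add: subgroup.m_closed subgroup.m_inv_closed)
  also have "g \<otimes> h \<otimes> inv g \<otimes> inv g \<otimes> (g \<otimes> g) \<otimes> inv h = g"
  proof -
    have "g \<otimes> h \<otimes> inv g \<otimes> inv g \<otimes> (g \<otimes> g) \<otimes> inv h = g \<otimes> h \<otimes> (inv g \<otimes> (inv g \<otimes> g) \<otimes> g) \<otimes> inv h"
      using assms(4) hG by (simp only: m_assoc m_closed inv_closed)
    thus ?thesis using assms(4) hG by (simp add: m_assoc)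
  qed
  finally show False using g by simp
qed

text \<open>The quotient is a 2-group. The exponent is left open because it will be 2 for the index
  four subgroup itself and 3 for subgroups of index two in it.\<close>

lemma (in group) supersolvable_normal_cyclic_two_power_index:
  assumes fin: "finite (carrier G)" and y: "y \<in> carrier G" and N: "generate G {y} \<lhd> G"
    and ord: "order G = 2 ^ a * ord y"
  shows "supersolvable G"
proof (rule supersolvable_of_quotient[OF N super_chain_generate[OF y N]])
  fix Q :: "'a monoid" and f
  assume Q: "group_hom G Q f" "order Q * card (generate G {y}) = order G"
  hence "order Q = 2 ^ a" using ord generate_pow_card[OF y] ord_ge_1[OF fin y] by simp
  thus "supersolvable Q" using supersolvable_prime_power_order[of Q 2 a] Q(1) by (simp add: group_hom_def)
qed

text \<open>A has index two in M and M has index two in G, so conjugates of x lie in M and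
  conjugates of x^2 in A. For even ord x the group generated by x^2 is therefore normal; for ord x =
  2l + 1, x = (x^2)^(l+1) and A itself is normal.\<close>

lemma (in group) index_four_nonmaximal:
  assumes fin: "finite (carrier G)" and x: "x \<in> carrier G" and ord: "order G = 4 * ord x"
    and M: "subgroup M G" "generate G {x} \<subseteq> M" "M \<noteq> generate G {x}" "M \<noteq> carrier G"
  shows "supersolvable G"
proof -
  let ?A = "generate G {x}"
  have A: "subgroup ?A G" using generate_singleton_subgroup[OF x] .
  have N0: "ord x > 0" using ord_ge_1[OF fin x] by simp
  have finM: "finite M" using finite_subset[OF subgroup.subset[OF M(1)] fin] .
  have "card M = 2 * ord x"
  proof -
    have "ord x dvd card M" using card_subgroup_dvd[OF A M(1,2)] generate_pow_card[OF x] by simp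
    then obtain t where t: "card M = ord x * t" by blast
    have "card M dvd 4 * ord x"
      using card_subgroup_dvd[OF M(1) subgroup_self subgroup.subset[OF M(1)]] ord by (simp add: order_def)
    hence t4: "t dvd 4" using t N0 by (simp add: mult.commute)
    have "t \<noteq> 1" using card_subset_eq[OF finM M(2)] t generate_pow_card[OF x] M(3) by auto
    moreover have "t \<noteq> 4"
      using card_subset_eq[OF fin subgroup.subset[OF M(1)]] t ord M(4) by (auto simp: order_def mult.commute)
    moreover have "t \<noteq> 3" using t4 by auto
    moreover have "t \<le> 4" using t4 by (rule dvd_imp_le) simp
    moreover have "t \<noteq> 0" using t4 by (metis dvd_0_left_iff zero_neq_numeral)
    ultimately have "t = 2" by linarith
    thus ?thesis using t by simp
  qed
  hence cM: "card M = 2 * card ?A" "order G = 2 * card M" using generate_pow_card[OF x] ord by simp_all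
  have conj2: "g \<otimes> x [^] (2::nat) \<otimes> inv g \<in> ?A" if g: "g \<in> carrier G" for g
  proof -
    have "x \<in> M" using M(2) generate.incl[of x "{x}" G] by blast
    hence "g \<otimes> x \<otimes> inv g \<in> M" using index_two_conj[OF fin M(1) cM(2) g] by simp
    hence "(g \<otimes> x \<otimes> inv g) \<otimes> (g \<otimes> x \<otimes> inv g) \<in> ?A"
      using index_two_square[OF fin A M(1,2) cM(1)] by simp
    moreover have "(g \<otimes> x \<otimes> inv g) \<otimes> (g \<otimes> x \<otimes> inv g) = (g \<otimes> x \<otimes> inv g) [^] (2::nat)"
      using g x by (simp add: numeral_2_eq_2)
    ultimately show ?thesis using conj_pow[OF g x, of 2] by simp
  qed
  show ?thesis
  proof (cases "even (ord x)")
    case True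
    hence "generate G {x [^] (2::nat)} \<lhd> G" using normal_generate_pow[OF fin x _ conj2] by simp
    moreover have "ord x = 2 * ord (x [^] (2::nat))" using ord_pow[OF x True] True by simp
    ultimately show ?thesis
      using supersolvable_normal_cyclic_two_power_index[OF fin _ _, of "x [^] (2::nat)" 3] x ord by simp
  next
    case False
    then obtain l where l: "ord x = 2 * l + 1" by (auto elim: oddE)
    have "g \<otimes> x \<otimes> inv g \<in> ?A" if g: "g \<in> carrier G" for g
    proof -
      have e: "2 * (l + 1) = ord x + 1" using l by simp
      have "(x [^] (2::nat)) [^] (l + 1) = x [^] (2 * (l + 1))" by (rule nat_pow_pow[OF x])
      also have "\<dots> = x [^] ord x \<otimes> x [^] (1::nat)" unfolding e by (rule nat_pow_mult[OF x, symmetric])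
      also have "\<dots> = x" using x by simp
      finally have "(x [^] (2::nat)) [^] (l + 1) = x" .
      hence "g \<otimes> x \<otimes> inv g = (g \<otimes> x [^] (2::nat) \<otimes> inv g) [^] (l + 1)"
        using conj_pow[OF g, of "x [^] (2::nat)" "l + 1"] x by simp
      thus ?thesis using subgroup_nat_pow_closed[OF A conj2[OF g], of "l + 1"] by (simp only:)
    qed
    hence "?A \<lhd> G" using normal_generate_pow[OF fin x, of 1] x by simp
    thus ?thesis using supersolvable_normal_cyclic_two_power_index[OF fin x, of 2] ord by simp
  qed
qed

text \<open>Testing x alone describes the normaliser of A: a conjugate of A contained in A has the
  same finite size and so equals A, which gives closure under inverses.\<close>

lemma (in group) cyclic_normalizer_subgroup:
  assumes fin: "finite (carrier G)" and x: "x \<in> carrier G"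
  shows "subgroup {t \<in> carrier G. t \<otimes> x \<otimes> inv t \<in> generate G {x}} G" (is "subgroup ?M G")
proof (rule subgroupI)
  have A: "subgroup (generate G {x}) G" using generate_singleton_subgroup[OF x] .
  have "\<one> \<in> ?M" using x generate.incl[of x "{x}" G] by simp
  thus "?M \<noteq> {}" by blast
  fix t assume "t \<in> ?M"
  hence t: "t \<in> carrier G" "t \<otimes> x \<otimes> inv t \<in> generate G {x}" by auto
  have tx: "t \<otimes> x \<otimes> inv t \<in> carrier G" using t x by simp
  have "generate G {t \<otimes> x \<otimes> inv t} = generate G {x}"
  proof (rule card_subset_eq)
    show "finite (generate G {x})" using finite_subset[OF subgroup.subset[OF A] fin] .
    show "generate G {t \<otimes> x \<otimes> inv t} \<subseteq> generate G {x}" using generate_singleton_subset[OF A t(2)] .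
    show "card (generate G {t \<otimes> x \<otimes> inv t}) = card (generate G {x})"
      using generate_pow_card[OF tx] generate_pow_card[OF x] ord_conj[OF t(1) x] by simp
  qed
  hence "x \<in> (\<lambda>a. t \<otimes> a \<otimes> inv t) ` generate G {x}"
    using generate_conj[OF fin x t(1)] generate.incl[of x "{x}" G] by simp
  then obtain a where a: "a \<in> generate G {x}" "x = t \<otimes> a \<otimes> inv t" by blast
  have "inv t \<otimes> (t \<otimes> a \<otimes> inv t) \<otimes> t = a"
    using conj_cancel(1)[OF t(1)] subgroup.mem_carrier[OF A a(1)] by simp
  hence "inv t \<otimes> x \<otimes> t = a" using a(2) by simp
  thus "inv t \<in> ?M" using t(1) a(1) by simp
  fix s assume "s \<in> ?M"
  hence s: "s \<in> carrier G" "s \<otimes> x \<otimes> inv s \<in> generate G {x}" by auto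
  then obtain j :: nat where j: "s \<otimes> x \<otimes> inv s = x [^] j" using mem_generateE[OF fin x] by blast
  have "t \<otimes> s \<otimes> x \<otimes> inv (t \<otimes> s) = t \<otimes> (s \<otimes> x \<otimes> inv s) \<otimes> inv t"
    using t(1) s(1) x by (simp add: inv_mult_group m_assoc)
  also have "\<dots> = (t \<otimes> x \<otimes> inv t) [^] j" using j conj_pow[OF t(1) x] by simp
  also have "\<dots> \<in> generate G {x}" using subgroup_nat_pow_closed[OF A t(2)] .
  finally show "t \<otimes> s \<in> ?M" using t(1) s(1) by simp
qed auto

text \<open>If A is maximal and not normal, K is central and the strict product estimate leaves only
  2 and 3 as its index in A. Index 2 makes G/K a 2-group; index 3 is the configuration of
  \<open>index_four_group\<close>.\<close>

lemma (in group) supersolvable_or_psi_le_index_four: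
  assumes fin: "finite (carrier G)" and x: "x \<in> carrier G" and ord: "order G = 4 * ord x"
  shows "supersolvable G \<or> 77 * psi G \<le> 31 * cyclic_order_sum (order G)"
proof (cases "generate G {x} \<lhd> G \<or>
    (\<exists>M. subgroup M G \<and> generate G {x} \<subseteq> M \<and> M \<noteq> generate G {x} \<and> M \<noteq> carrier G)")
  case True
  thus ?thesis
    using supersolvable_normal_cyclic_two_power_index[OF fin x, of 2] ord index_four_nonmaximal[OF fin x ord] by auto
next
  case False
  let ?A = "generate G {x}"
  let ?B = "\<lambda>g. generate G {g \<otimes> x \<otimes> inv g}"
  have A: "subgroup ?A G" using generate_singleton_subgroup[OF x] .
  have AG: "?A \<subseteq> carrier G" using subgroup.subset[OF A] .
  have N0: "ord x > 0" using ord_ge_1[OF fin x] by simp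
  have max: "M = ?A \<or> M = carrier G" if "subgroup M G" "?A \<subseteq> M" for M
    using False that by blast
  obtain g where g: "g \<in> carrier G" "g \<otimes> x \<otimes> inv g \<notin> ?A"
    using not_normal_generate[OF fin x] False by blast
  let ?K = "?A \<inter> ?B g"
  have gx: "g \<otimes> x \<otimes> inv g \<in> carrier G" using g x by simp
  have K: "subgroup ?K G" using subgroup_Int[OF A generate_singleton_subgroup[OF gx]] .
  have ne: "?B g \<noteq> ?A" using g(2) generate.incl[of "g \<otimes> x \<otimes> inv g" "{g \<otimes> x \<otimes> inv g}" G] by auto
  have central: "h \<otimes> z = z \<otimes> h" if "z \<in> ?K" "h \<in> carrier G" for z h
    using Int_conj_maximal_cyclic_central[OF fin x g(1) max ne that] .
  have N: "?K \<lhd> G" using central_subgroup_normal[OF K] central by blast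
  obtain d where d: "ord x = card ?K * d" using cyclic_subgroup_unique(1)[OF fin x K] by auto
  have cp: "card ?K > 0" "d > 0" using d N0 by (auto intro: gr0I)
  have "ord x * ord x < 4 * ord x * card ?K" using card_conj_Int[OF fin x g(1) ne] ord by simp
  hence d4: "d < 4" using d N0 by (simp add: mult.commute mult.left_commute)
  have Kgen: "?K = generate G {x [^] d}" using cyclic_subgroup_unique(2)[OF fin x K] d cp by simp
  have ordd: "ord (x [^] d) = card ?K" using ord_pow[OF x, of d] d cp by simp
  have "d \<noteq> 1"
  proof
    assume "d = 1"
    hence "?A = ?K" using Kgen x by simp
    hence "?A \<subseteq> ?B g" by blast
    moreover have "card (?B g) = card ?A"
      using generate_pow_card[OF x] generate_pow_card[OF gx] ord_conj[OF g(1) x] by simp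
    moreover have "finite (?B g)"
      using finite_subset[OF subgroup.subset[OF generate_singleton_subgroup[OF gx]] fin] .
    ultimately show False using ne card_subset_eq by metis
  qed
  then consider "d = 2" | "d = 3" using d4 cp(2) by linarith
  thus ?thesis
  proof cases
    case 1
    have "order G = 2 ^ 3 * ord (x [^] d)" using ord d 1 ordd by simp
    thus ?thesis
      using supersolvable_normal_cyclic_two_power_index[OF fin, of "x [^] d" 3] N Kgen x by simp
  next
    case 2
    have K3: "generate G {x [^] (3::nat)} = ?K" using Kgen 2 by simp
    have A4: "index_four_group G x"
    proof (unfold_locales)
      show "3 dvd ord x" using d 2 by simp
      show "h \<otimes> x [^] (3::nat) = x [^] (3::nat) \<otimes> h" if "h \<in> carrier G" for h
        using central[OF _ that, of "x [^] (3::nat)"] K3 generate.incl[of "x [^] (3::nat)" "{x [^] (3::nat)}" G] by auto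
    next
      fix h assume h: "h \<in> carrier G" "h \<notin> ?A"
      have hx: "h \<otimes> x \<otimes> inv h \<in> carrier G" using h x by simp
      have neh: "?B h \<noteq> ?A"
      proof -
        \<comment> \<open>Being maximal and not normal, A is its own normaliser, so every h outside
          A gives a different conjugate.\<close>
        have "?A \<subseteq> {t \<in> carrier G. t \<otimes> x \<otimes> inv t \<in> ?A}"
          using A AG generate.incl[of x "{x}" G] by (auto intro!: subgroup.m_closed subgroup.m_inv_closed)
        hence "{t \<in> carrier G. t \<otimes> x \<otimes> inv t \<in> ?A} = ?A"
          using max[OF cyclic_normalizer_subgroup[OF fin x]] g by blast
        hence "h \<otimes> x \<otimes> inv h \<notin> ?A" using h by blast
        thus ?thesis using generate.incl[of "h \<otimes> x \<otimes> inv h" "{h \<otimes> x \<otimes> inv h}" G] by auto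
      qed
      have z: "l \<otimes> z = z \<otimes> l" if "z \<in> ?A \<inter> ?B h" "l \<in> carrier G" for z l
        using Int_conj_maximal_cyclic_central[OF fin x h(1) max neh that] .
      have fixed: "t \<otimes> z \<otimes> inv t = z" if "t \<in> carrier G" "z \<in> carrier G" "t \<otimes> z = z \<otimes> t" for t z
        using that by (simp add: m_assoc)
      \<comment> \<open>Elements of either intersection are central, and central elements of A lie
        in every conjugate of A, so the intersection is the same for all h outside A.\<close>
      have "?A \<inter> ?B h = ?K"
      proof (intro equalityI subsetI)
        fix z assume zz: "z \<in> ?A \<inter> ?B h"
        hence "z = g \<otimes> z \<otimes> inv g" using fixed[OF g(1) _ z[OF zz g(1), symmetric, THEN sym]] AG by auto
        thus "z \<in> ?K" using zz generate_conj[OF fin x g(1)] by auto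
      next
        fix z assume zz: "z \<in> ?K"
        hence "z = h \<otimes> z \<otimes> inv h" using fixed[OF h(1) _ central[OF zz h(1)]] AG by auto
        thus "z \<in> ?A \<inter> ?B h" using zz generate_conj[OF fin x h(1)] by auto
      qed
      thus "?A \<inter> ?B h = generate G {x [^] (3::nat)}" using K3 by simp
    qed (use fin x ord in auto)
    show ?thesis using index_four_group.psi_le[OF A4] by simp
  qed
qed

section \<open>The main theorem\<close>

lemma (in group) supersolvable_step:
  assumes fin: "finite (carrier G)" and psi: "31 * cyclic_order_sum (order G) < 77 * psi G"
    and IH: "\<And>Q :: 'a monoid. group Q \<Longrightarrow> finite (carrier Q) \<Longrightarrow> order Q < order G \<Longrightarrow>
      31 * cyclic_order_sum (order Q) < 77 * psi Q \<Longrightarrow> supersolvable Q"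
  shows "supersolvable G"
proof -
  have n0: "order G > 0" using fin order_gt_0_iff_finite by simp
  have "\<exists>x\<in>carrier G. psi G \<le> order G * ord x"
  proof -
    have "Max (ord ` carrier G) \<in> ord ` carrier G" using fin one_closed by (intro Max_in) auto
    then obtain x where x: "x \<in> carrier G" "ord x = Max (ord ` carrier G)" by auto
    have "(\<Sum>g\<in>carrier G. ord g) \<le> card (carrier G) * ord x"
      using sum_bounded_above[of "carrier G" ord "ord x"] x fin by simp
    thus ?thesis unfolding psi_def order_def using x(1) by (rule bexI)
  qed
  then obtain x where x: "x \<in> carrier G" "psi G \<le> order G * ord x" by blast
  have "ord x dvd order G" using ord_dvd_group_order[OF x(1)] .
  then obtain i where i: "order G = i * ord x" by (metis dvdE mult.commute)
  have i0: "i > 0" using i n0 by (auto intro: gr0I)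
  have "31 * cyclic_order_sum (order G) < 77 * (order G * ord x)" using psi x(2) by linarith
  hence "i * (31 * cyclic_order_sum (order G)) < i * (77 * (order G * ord x))" using i0 by simp
  also have "i * (77 * (order G * ord x)) = 77 * order G ^ 2" using i by (simp add: power2_eq_square)
  finally have bound: "31 * i * cyclic_order_sum (order G) < 77 * order G ^ 2" by (simp add: mult_ac)
  \<comment> \<open>Below 6 only 1 and 4 fail to be prime: 1 means that G is cyclic, and 4 is where
    A4 occurs.\<close>
  have "i \<ge> 6 \<or> i = 1 \<or> i = 4 \<or> prime i"
  proof -
    have "prime (2::nat)" "prime (3::nat)" "prime (5::nat)" by simp_all
    moreover have "i \<ge> 6 \<or> i = 1 \<or> i = 2 \<or> i = 3 \<or> i = 4 \<or> i = 5" using i0 by linarith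
    ultimately show ?thesis by auto
  qed
  then consider "i \<ge> 6" | "i = 1" | "i = 4" | "prime i" by blast
  thus ?thesis
  proof cases
    case 1
    then obtain p where p: "prime p" "p dvd order G" "i < p"
      using large_prime_divisor[OF n0 _ bound] by blast
    obtain y a m where y: "order G = p ^ a * m" "\<not> p dvd m" "m > 0" "a > 0" "y \<in> carrier G"
      "ord y = p ^ a" "generate G {y} \<lhd> G"
      using normal_cyclic_sylow[OF fin x(1) p(1,2) i p(3)] .
    have p1: "1 < p ^ a" using y(4) p(1) prime_gt_1_nat one_less_power by blast
    show ?thesis
    proof (rule supersolvable_of_quotient[OF y(7) super_chain_generate[OF y(5,7)]])
      fix Q :: "'a monoid" and f
      assume Q: "group_hom G Q f" "f ` carrier G = carrier Q" "kernel G Q f = generate G {y}"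
        "order Q * card (generate G {y}) = order G"
      interpret f: group_hom G Q f by fact
      have "order Q * p ^ a = m * p ^ a"
        using Q(4) y(1,6) generate_pow_card[OF y(5)] by (simp add: mult.commute)
      moreover have "p ^ a \<noteq> 0" using p1 by linarith
      ultimately have m: "order Q = m" by (metis mult_cancel2)
      have "coprime (ord y) (order Q)"
        unfolding y(6) m using p(1) y(2) by (simp add: prime_imp_coprime)
      hence "psi G \<le> cyclic_order_sum (p ^ a) * psi Q"
        using f.psi_le_of_coprime_cyclic_kernel[OF fin y(5) Q(2,3)] y(6) by simp
      hence le: "77 * psi G \<le> 77 * (cyclic_order_sum (p ^ a) * psi Q)" by (rule mult_le_mono2)
      have "31 * (cyclic_order_sum (p ^ a) * cyclic_order_sum m) < 77 * psi G"
        using psi cyclic_order_sum_prime_power_mult[OF p(1) y(2,3), of a] y(1) by simp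
      also note le
      finally have "cyclic_order_sum (p ^ a) * (31 * cyclic_order_sum m) < cyclic_order_sum (p ^ a) * (77 * psi Q)"
        by (simp only: mult.left_commute)
      hence "31 * cyclic_order_sum m < 77 * psi Q" by (metis mult_less_cancel1)
      hence "31 * cyclic_order_sum (order Q) < 77 * psi Q" using m by simp
      moreover have "order Q < order G" using m y(1,3) p1 by simp
      moreover have "finite (carrier Q)" using Q(2) fin by (metis finite_imageI)
      ultimately show "supersolvable Q" using IH f.H.is_group by blast
    qed
  next
    case 2
    have "generate G {x} = carrier G"
      using generate_pow_card[OF x(1)] i 2 fin subgroup.subset[OF generate_singleton_subgroup[OF x(1)]]
      by (intro card_subset_eq) (auto simp: order_def)
    hence "super_chain G (carrier G)" using super_chain_generate[OF x(1)] normal_self by simp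
    thus ?thesis using supersolvable_iff by simp
  next
    case 3
    thus ?thesis using supersolvable_or_psi_le_index_four[OF fin x(1)] i psi by auto
  next
    case 4
    thus ?thesis using supersolvable_prime_index[OF fin x(1)] i by blast
  qed
qed

theorem mainTheorem1:
  fixes G :: "('a, 'b) monoid_scheme" and n :: nat
  assumes "group G" and "finite (carrier G)" and "order G = n"
    and "real (psi G) > 31 / 77 * real (psi (integer_mod_group n))"
  shows "supersolvable G"
proof -
  interpret group G by fact
  \<comment> \<open>Quotients are plain monoids while G may be an extended record, so the induction
    is done for \<open>'a monoid\<close> and the step is applied once more to G itself.\<close>
  have mon: "supersolvable Q" if "group Q" "finite (carrier Q)" "order Q = m"
    "31 * cyclic_order_sum m < 77 * psi Q" for Q :: "'a monoid" and m
    using that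
  proof (induction m arbitrary: Q rule: less_induct)
    case (less m)
    show ?case
    proof (rule group.supersolvable_step[OF less.prems(1,2)])
      show "31 * cyclic_order_sum (order Q) < 77 * psi Q" using less.prems by simp
      fix P :: "'a monoid"
      assume "group P" "finite (carrier P)" "order P < order Q" "31 * cyclic_order_sum (order P) < 77 * psi P"
      thus "supersolvable P" using less.IH[of "order P" P] less.prems(3) by simp
    qed
  qed
  have "n > 0" using assms(2,3) order_gt_0_iff_finite by simp
  hence "31 * real (cyclic_order_sum n) < 77 * real (psi G)"
    using assms(4) by (simp add: psi_integer_mod_group)
  hence "real (31 * cyclic_order_sum n) < real (77 * psi G)" by simp
  hence "31 * cyclic_order_sum n < 77 * psi G" by (simp only: of_nat_less_iff)
  thus ?thesis using supersolvable_step[OF assms(2)] mon assms(3) by simp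
qed

end
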